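(* Let $m$ be an integer with $|m|\geq 2$, and let $X_m\subset\mathcal{G}_2$ be the set of the marked groups $BS(m,n)$ for $n$ an integer relatively prime to $m$ with $|n|\geq 2$. Then the map $\Psi:X_m\to\mathbb{Z}_m^{\times}$, $BS(m,n)\mapsto n$, extends continuously to the closure $\overline{X_m}$ of $X_m$ in $\mathcal{G}_2$. The extension $\overline{X_m}\to\mathbb{Z}_m^\times$ is surjective, but not injective.
   Context: For nonzero integers $m,n$, $BS(m,n)=\langle a,b\mid ab^{m}a^{-1}=b^{n}\rangle$, marked by $(a,b)$. A marked group on $k$ generators is a pair $(\Gamma,S)$ with $\Gamma$ a group and $S=(s_1,\dots,s_k)$ a family generating $\Gamma$. Two marked groups $(\Gamma,S)$, $(\Gamma',S')$ are identified if there is a group isomorphism $\Gamma\to\Gamma'$ sending $s_i$ to $s'_i$ for each $i$; $\mathcal{G}_k$ is the set of marked groups on $k$ generators up to this identification. The topology on $\mathcal{G}_k$ is given by the ultrametric $d\big((\Gamma_1,S_1),(\Gamma_2,S_2)\big)=e^{-\lambda}$ for distinct marked groups, where $\lambda$ is the length of a shortest element of the free group $\mathbb{F}_k$ which is trivial in one of the groups and not in the other (under the canonical epimorphisms from $\mathbb{F}_k$). For $|m|\geq 2$ ($m$ not necessarily prime), $\mathbb{Z}_m$ denotes the ring of $m$-adic integers: the completion of $\mathbb{Z}$ with respect to the ultrametric distance $(x,y)\mapsto|x-y|_m$, where $|a m^{k}|_m=|m|^{-k}$ for $a$ not a multiple of $m$ and $k\geq0$ (and $|0|_m=0$), with ring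 operations extended by continuity. Equivalently, $\mathbb{Z}_m$ is the topological ring $\varprojlim_h \mathbb{Z}/m^h\mathbb{Z}$. $\mathbb{Z}_m^{\times}$ is its group of invertible elements, with the topology induced by the $m$-adic distance; integers relatively prime to $m$ are in $\mathbb{Z}_m^\times$. *)

theory Defs
  imports "HOL-Analysis.Analysis" "HOL-Algebra.Ring" "HOL-Algebra.Generated_Groups"
begin

(* clashes with the topological closure operator *)
no_notation eq_closure_of (\<open>closure'_of\<index>\<close>)

text \<open>Free groups. A letter is a generator index together with a sign (True for the generator
  itself, False for its inverse); the elements of the free group are the reduced words.\<close>

type_synonym letter = "nat \<times> bool"

definition inv_letter :: "letter \<Rightarrow> letter" where
  "inv_letter x = (fst x, \<not> snd x)"

definition reduced_word :: "letter list \<Rightarrow> bool" where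
  "reduced_word w \<longleftrightarrow> successively (\<lambda>x y. y \<noteq> inv_letter x) w"

fun red_cons :: "letter \<Rightarrow> letter list \<Rightarrow> letter list" where
  "red_cons x [] = [x]"
| "red_cons x (y # w) = (if y = inv_letter x then w else x # y # w)"

definition free_group :: "nat \<Rightarrow> letter list monoid" where
  "free_group k = \<lparr>carrier = {w. reduced_word w \<and> fst ` set w \<subseteq> {..<k}},
                   mult = foldr red_cons, one = []\<rparr>"

abbreviation free_gen :: "nat \<Rightarrow> letter list" where
  "free_gen i \<equiv> [(i, True)]"

definition normal_closure :: "('a, 'b) monoid_scheme \<Rightarrow> 'a set \<Rightarrow> 'a set" where
  "normal_closure G R = \<Inter>{N. N \<lhd> G \<and> R \<subseteq> N}"

definition marked_group :: "nat \<Rightarrow> 'a monoid \<Rightarrow> 'a list \<Rightarrow> bool" where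
  "marked_group k G S \<longleftrightarrow>
     group G \<and> length S = k \<and> set S \<subseteq> carrier G \<and> generate G (set S) = carrier G"

definition marked_iso :: "'a monoid \<Rightarrow> 'a list \<Rightarrow> 'b monoid \<Rightarrow> 'b list \<Rightarrow> bool" where
  "marked_iso G S H T \<longleftrightarrow> (\<exists>h \<in> iso G H. map h S = T)"

definition letter_eval :: "'a monoid \<Rightarrow> 'a list \<Rightarrow> letter \<Rightarrow> 'a" where
  "letter_eval G S x = (if snd x then S ! fst x else inv\<^bsub>G\<^esub> (S ! fst x))"

definition word_eval :: "'a monoid \<Rightarrow> 'a list \<Rightarrow> letter list \<Rightarrow> 'a" where
  "word_eval G S w = foldr (\<lambda>x g. letter_eval G S x \<otimes>\<^bsub>G\<^esub> g) w \<one>\<^bsub>G\<^esub>"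

text \<open>The space of marked groups. HOL cannot quantify over groups of all types at once, so the
  carriers are taken in the type of sets of words, where the cosets of a normal subgroup of a free
  group live. No marked group is lost, see \<open>marked_group_universe\<close> below.\<close>

type_synonym marked = "letter list set monoid \<times> letter list set list"

definition marked_iso_rel :: "nat \<Rightarrow> (marked \<times> marked) set" where
  "marked_iso_rel k =
     {((G, S), (H, T)). marked_group k G S \<and> marked_group k H T \<and> marked_iso G S H T}"

definition marked_groups :: "nat \<Rightarrow> marked set set" where
  "marked_groups k = {(G, S). marked_group k G S} // marked_iso_rel k"

definition trivial_word :: "marked set \<Rightarrow> letter list \<Rightarrow> bool" where
  "trivial_word X w \<longleftrightarrow> (\<exists>G S. (G, S) \<in> X \<and> word_eval G S w = \<one>\<^bsub>G\<^esub>)"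

definition marked_dist :: "nat \<Rightarrow> marked set \<Rightarrow> marked set \<Rightarrow> real" where
  "marked_dist k X Y =
     (if X = Y then 0
      else exp (- real (LEAST l. \<exists>w \<in> carrier (free_group k).
                          length w = l \<and> trivial_word X w \<noteq> trivial_word Y w)))"

definition marked_topology :: "nat \<Rightarrow> marked set topology" where
  "marked_topology k = Metric_space.mtopology (marked_groups k) (marked_dist k)"

text \<open>In the Baumslag--Solitar groups generator 0 is a and generator 1 is b.\<close>

definition presented_group :: "nat \<Rightarrow> letter list set \<Rightarrow> letter list set monoid" where
  "presented_group k R = free_group k Mod normal_closure (free_group k) R"

definition presented_marking :: "nat \<Rightarrow> letter list set \<Rightarrow> letter list set list" where
  "presented_marking k R =
     map (\<lambda>i. normal_closure (free_group k) R #>\<^bsub>free_group k\<^esub> free_gen i) [0..<k]"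

definition BS_relator :: "int \<Rightarrow> int \<Rightarrow> letter list" where
  "BS_relator m n =
     (let F = free_group 2; a = free_gen 0; b = free_gen 1
      in a \<otimes>\<^bsub>F\<^esub> (b [^]\<^bsub>F\<^esub> m) \<otimes>\<^bsub>F\<^esub> inv\<^bsub>F\<^esub> a \<otimes>\<^bsub>F\<^esub> inv\<^bsub>F\<^esub> (b [^]\<^bsub>F\<^esub> n))"

definition BS :: "int \<Rightarrow> int \<Rightarrow> marked set" where
  "BS m n = marked_iso_rel 2 ``
     {(presented_group 2 {BS_relator m n}, presented_marking 2 {BS_relator m n})}"

definition BS_coprime :: "int \<Rightarrow> marked set set" where
  "BS_coprime m = {BS m n | n. coprime n m \<and> \<bar>n\<bar> \<ge> 2}"

text \<open>The ring of m-adic integers as the completion of the integers: Cauchy sequences modulo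
  null sequences.\<close>

definition madic_abs :: "int \<Rightarrow> int \<Rightarrow> real" where
  "madic_abs m x = (if x = 0 then 0 else 1 / real_of_int \<bar>m\<bar> ^ multiplicity m x)"

definition madic_dist :: "int \<Rightarrow> int \<Rightarrow> int \<Rightarrow> real" where
  "madic_dist m x y = madic_abs m (x - y)"

definition madic_Cauchy :: "int \<Rightarrow> (nat \<Rightarrow> int) set" where
  "madic_Cauchy m = {x. Metric_space.MCauchy UNIV (madic_dist m) x}"

definition madic_rel :: "int \<Rightarrow> ((nat \<Rightarrow> int) \<times> (nat \<Rightarrow> int)) set" where
  "madic_rel m = {(x, y). x \<in> madic_Cauchy m \<and> y \<in> madic_Cauchy m \<and>
                          (\<lambda>i. madic_dist m (x i) (y i)) \<longlonglongrightarrow> 0}"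

definition madic_class :: "int \<Rightarrow> (nat \<Rightarrow> int) \<Rightarrow> (nat \<Rightarrow> int) set" where
  "madic_class m x = madic_rel m `` {x}"

definition madic_of_int :: "int \<Rightarrow> int \<Rightarrow> (nat \<Rightarrow> int) set" where
  "madic_of_int m n = madic_class m (\<lambda>_. n)"

definition madic_ring :: "int \<Rightarrow> (nat \<Rightarrow> int) set ring" where
  "madic_ring m =
     \<lparr>carrier = madic_Cauchy m // madic_rel m,
      mult = (\<lambda>X Y. \<Union>x\<in>X. \<Union>y\<in>Y. madic_class m (\<lambda>i. x i * y i)),
      one = madic_of_int m 1,
      zero = madic_of_int m 0,
      add = (\<lambda>X Y. \<Union>x\<in>X. \<Union>y\<in>Y. madic_class m (\<lambda>i. x i + y i))\<rparr>"

text \<open>Outside the carrier the distance is set to 0, because \<open>Metric_space\<close> asks for nonnegativity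
  and symmetry on the whole type.\<close>

definition madic_int_dist :: "int \<Rightarrow> (nat \<Rightarrow> int) set \<Rightarrow> (nat \<Rightarrow> int) set \<Rightarrow> real" where
  "madic_int_dist m X Y =
     (if X \<in> carrier (madic_ring m) \<and> Y \<in> carrier (madic_ring m)
      then THE d. \<forall>x\<in>X. \<forall>y\<in>Y. (\<lambda>i. madic_dist m (x i) (y i)) \<longlonglongrightarrow> d
      else 0)"

definition madic_topology :: "int \<Rightarrow> (nat \<Rightarrow> int) set topology" where
  "madic_topology m = Metric_space.mtopology (carrier (madic_ring m)) (madic_int_dist m)"

definition madic_units_topology :: "int \<Rightarrow> (nat \<Rightarrow> int) set topology" where
  "madic_units_topology m = subtopology (madic_topology m) (Units (madic_ring m))"

definition BS_closure :: "int \<Rightarrow> marked set set" where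
  "BS_closure m = marked_topology 2 closure_of BS_coprime m"

text \<open>Continuous extensions to the closure of the map sending BS(m,n) to n. That this map is
  well defined is part of the existence of such an extension.\<close>

definition continuous_extension :: "int \<Rightarrow> (marked set \<Rightarrow> (nat \<Rightarrow> int) set) \<Rightarrow> bool" where
  "continuous_extension m \<Phi> \<longleftrightarrow>
     continuous_map (subtopology (marked_topology 2) (BS_closure m)) (madic_units_topology m) \<Phi> \<and>
     (\<forall>n. coprime n m \<and> \<bar>n\<bar> \<ge> 2 \<longrightarrow> \<Phi> (BS m n) = madic_of_int m n)"

lemma inv_letter_simps [simp]:
  "inv_letter (inv_letter x) = x" "inv_letter x \<noteq> x" "x \<noteq> inv_letter x" "fst (inv_letter x) = fst x"
  "inv_letter x = inv_letter y \<longleftrightarrow> x = y"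
  by (auto simp: inv_letter_def prod_eq_iff)

lemma reduced_Nil [simp]: "reduced_word []"
  by (simp add: reduced_word_def)

lemma reduced_Cons:
  "reduced_word (x # w) \<longleftrightarrow> reduced_word w \<and> (w = [] \<or> hd w \<noteq> inv_letter x)"
  by (cases w) (auto simp: reduced_word_def)

lemma reduced_red_cons: "reduced_word w \<Longrightarrow> reduced_word (red_cons x w)"
  by (cases w) (auto simp: reduced_Cons)

lemma red_cons_cancel: "reduced_word w \<Longrightarrow> red_cons x (red_cons (inv_letter x) w) = w"
  by (cases w rule: list.exhaust; cases "tl w") (auto simp: reduced_Cons)

lemma red_cons_reduced: "reduced_word (x # w) \<Longrightarrow> red_cons x w = x # w"
  by (cases w) (auto simp: reduced_Cons)

lemma reduced_foldr: "reduced_word v \<Longrightarrow> reduced_word (foldr red_cons u v)"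
  by (induction u) (auto simp: reduced_red_cons)

lemma letters_red_cons: "set (red_cons x w) \<subseteq> insert x (set w)"
  by (cases w) auto

lemma letters_foldr: "set (foldr red_cons u v) \<subseteq> set u \<union> set v"
  using letters_red_cons by (induction u) fastforce+

lemma fst_letters_foldr:
  "fst ` set u \<subseteq> A \<Longrightarrow> fst ` set v \<subseteq> A \<Longrightarrow> fst ` set (foldr red_cons u v) \<subseteq> A"
  using letters_foldr[of u v] by (simp add: image_subset_iff) blast

lemma foldr_red_cons:
  "reduced_word v \<Longrightarrow> foldr red_cons (red_cons x u) v = red_cons x (foldr red_cons u v)"
  by (cases u) (auto simp: red_cons_cancel reduced_foldr)

lemma foldr_red_cons_assoc:
  "reduced_word w \<Longrightarrow>
   foldr red_cons (foldr red_cons u v) w = foldr red_cons u (foldr red_cons v w)"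
  by (induction u) (auto simp: foldr_red_cons)

lemma foldr_red_cons_Nil: "reduced_word u \<Longrightarrow> foldr red_cons u [] = u"
  by (induction u) (auto simp: red_cons_reduced reduced_Cons)

lemma reduced_append_right: "reduced_word (u @ v) \<Longrightarrow> reduced_word v"
  by (induction u) (auto simp: reduced_Cons)

lemma foldr_red_cons_inv:
  "reduced_word u \<Longrightarrow> foldr red_cons (rev (map inv_letter u)) u = []"
proof -
  have "foldr red_cons (rev (map inv_letter u)) (u @ v) = v" if "reduced_word (u @ v)" for v
    using that
  proof (induction u)
    case (Cons x u)
    have "red_cons (inv_letter x) (x # u @ v) = u @ v" by simp
    with Cons show ?case by (auto simp: reduced_Cons)
  qed simp
  from this[of "[]"] show "reduced_word u \<Longrightarrow> ?thesis" by simp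
qed

lemma reduced_inverse: "reduced_word u \<Longrightarrow> reduced_word (rev (map inv_letter u))"
  unfolding reduced_word_def successively_rev successively_map
  by (erule successively_mono) auto

lemma free_group_group: "group (free_group k)"
proof (rule groupI)
  fix u v assume "u \<in> carrier (free_group k)" "v \<in> carrier (free_group k)"
  then show "u \<otimes>\<^bsub>free_group k\<^esub> v \<in> carrier (free_group k)"
    using fst_letters_foldr[of u _ v] by (simp add: free_group_def reduced_foldr)
next
  fix u assume u: "u \<in> carrier (free_group k)"
  show "\<exists>v\<in>carrier (free_group k). v \<otimes>\<^bsub>free_group k\<^esub> u = \<one>\<^bsub>free_group k\<^esub>"
    by (rule bexI[of _ "rev (map inv_letter u)"])
       (use u in \<open>auto simp: free_group_def foldr_red_cons_inv reduced_inverse\<close>)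
qed (auto simp: free_group_def foldr_red_cons_assoc)

lemma letter_eval_closed:
  assumes "marked_group k G S" "fst x < k"
  shows "letter_eval G S x \<in> carrier G"
proof -
  interpret group G using assms by (simp add: marked_group_def)
  have "S ! fst x \<in> carrier G" using assms by (auto simp: marked_group_def)
  then show ?thesis by (simp add: letter_eval_def)
qed

lemma word_eval_simps [simp]:
  "word_eval G S [] = \<one>\<^bsub>G\<^esub>"
  "word_eval G S (x # w) = letter_eval G S x \<otimes>\<^bsub>G\<^esub> word_eval G S w"
  by (simp_all add: word_eval_def)

lemma word_eval_closed:
  assumes "marked_group k G S" "fst ` set w \<subseteq> {..<k}"
  shows "word_eval G S w \<in> carrier G"
proof -
  interpret group G using assms by (simp add: marked_group_def)
  show ?thesis using assms(2)
    by (induction w) (auto simp: letter_eval_closed[OF assms(1)])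
qed

lemma letter_eval_inv:
  assumes "marked_group k G S" "fst x < k"
  shows "letter_eval G S (inv_letter x) = inv\<^bsub>G\<^esub> (letter_eval G S x)"
proof -
  interpret group G using assms by (simp add: marked_group_def)
  have "S ! fst x \<in> carrier G" using assms by (auto simp: marked_group_def)
  then show ?thesis by (simp add: letter_eval_def inv_letter_def)
qed

lemma word_eval_red_cons:
  assumes "marked_group k G S" "fst x < k" "fst ` set w \<subseteq> {..<k}"
  shows "word_eval G S (red_cons x w) = letter_eval G S x \<otimes>\<^bsub>G\<^esub> word_eval G S w"
proof -
  interpret group G using assms by (simp add: marked_group_def)
  show ?thesis
  proof (cases w)
    case (Cons y v)
    have "letter_eval G S x \<in> carrier G" "word_eval G S v \<in> carrier G"
      using assms Cons by (auto simp: letter_eval_closed word_eval_closed)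
    then show ?thesis using Cons assms
      by (auto simp: letter_eval_inv m_assoc[symmetric])
  qed simp
qed

lemma word_eval_foldr:
  assumes "marked_group k G S" "fst ` set u \<subseteq> {..<k}" "fst ` set v \<subseteq> {..<k}"
  shows "word_eval G S (foldr red_cons u v) = word_eval G S u \<otimes>\<^bsub>G\<^esub> word_eval G S v"
proof -
  interpret group G using assms by (simp add: marked_group_def)
  show ?thesis using assms(2)
  proof (induction u)
    case Nil
    then show ?case using assms by (simp add: word_eval_closed)
  next
    case (Cons x u)
    have "fst ` set (foldr red_cons u v) \<subseteq> {..<k}"
      using letters_foldr[of u v] Cons.prems assms(3) by fastforce
    with Cons show ?case
      using assms by (auto simp: word_eval_red_cons m_assoc letter_eval_closed word_eval_closed)
  qed
qed

lemma word_eval_hom: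
  assumes "marked_group k G S"
  shows "word_eval G S \<in> hom (free_group k) G"
  using assms by (intro homI) (auto simp: free_group_def word_eval_closed word_eval_foldr)

lemma word_eval_surj:
  assumes "marked_group k G S"
  shows "word_eval G S ` carrier (free_group k) = carrier G"
proof
  show "word_eval G S ` carrier (free_group k) \<subseteq> carrier G"
    using assms by (auto simp: free_group_def word_eval_closed)
  interpret group G using assms by (simp add: marked_group_def)
  interpret h: group_hom "free_group k" G "word_eval G S"
    using assms by (simp add: group_hom_def group_hom_axioms_def word_eval_hom free_group_group is_group)
  have "subgroup (word_eval G S ` carrier (free_group k)) G"
    by (rule h.img_is_subgroup)
  moreover have "set S \<subseteq> word_eval G S ` carrier (free_group k)"
  proof
    fix s assume "s \<in> set S"
    then obtain i where i: "i < k" "s = S ! i" "s \<in> carrier G"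
      using assms unfolding marked_group_def by (metis in_set_conv_nth subsetD)
    then have "s = word_eval G S [(i, True)]" by (simp add: letter_eval_def)
    moreover have "[(i, True)] \<in> carrier (free_group k)"
      using i by (simp add: free_group_def reduced_word_def)
    ultimately show "s \<in> word_eval G S ` carrier (free_group k)" by blast
  qed
  ultimately have "generate G (set S) \<subseteq> word_eval G S ` carrier (free_group k)"
    by (intro generate_subgroup_incl)
  then show "carrier G \<subseteq> word_eval G S ` carrier (free_group k)"
    using assms by (simp add: marked_group_def)
qed

lemma word_eval_eq_iff:
  assumes "marked_group k G S" "u \<in> carrier (free_group k)" "v \<in> carrier (free_group k)"
  shows "word_eval G S u = word_eval G S v \<longleftrightarrow>
         word_eval G S (u \<otimes>\<^bsub>free_group k\<^esub> inv\<^bsub>free_group k\<^esub> v) = \<one>\<^bsub>G\<^esub>"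
proof -
  interpret G: group G using assms by (simp add: marked_group_def)
  interpret h: group_hom "free_group k" G "word_eval G S"
    using assms by (simp add: group_hom_def group_hom_axioms_def word_eval_hom free_group_group G.is_group)
  show ?thesis using assms(2,3) by simp (metis G.inv_equality G.inv_inv G.r_inv h.hom_closed G.inv_closed)
qed

lemma hom_word_eval:
  assumes "marked_group k G S" "marked_group k H T" "h \<in> hom G H" "map h S = T"
    and "fst ` set w \<subseteq> {..<k}"
  shows "h (word_eval G S w) = word_eval H T w"
proof -
  interpret h: group_hom G H h
    using assms by (simp add: group_hom_def group_hom_axioms_def marked_group_def)
  show ?thesis using assms(5)
  proof (induction w)
    case (Cons x w)
    have "S ! fst x \<in> carrier G" "T ! fst x = h (S ! fst x)"
      using assms Cons.prems by (auto simp: marked_group_def)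
    then have "h (letter_eval G S x) = letter_eval H T x"
      by (simp add: letter_eval_def)
    with Cons show ?case
      using assms(1) by (simp add: letter_eval_closed word_eval_closed)
  qed simp
qed

lemma marked_iso_iff:
  assumes G: "marked_group k G S" and H: "marked_group k H T"
  shows "marked_iso G S H T \<longleftrightarrow>
         (\<forall>w\<in>carrier (free_group k). word_eval G S w = \<one>\<^bsub>G\<^esub> \<longleftrightarrow> word_eval H T w = \<one>\<^bsub>H\<^esub>)"
    (is "?L \<longleftrightarrow> ?R")
proof
  assume ?L
  then obtain h where h: "h \<in> iso G H" "map h S = T" by (auto simp: marked_iso_def)
  interpret h: group_hom G H h
    using assms h by (simp add: group_hom_def group_hom_axioms_def marked_group_def iso_def)
  show ?R
  proof
    fix w assume w: "w \<in> carrier (free_group k)"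
    then have "h (word_eval G S w) = word_eval H T w"
      using hom_word_eval[OF G H _ h(2)] h(1) by (simp add: iso_def free_group_def)
    moreover have "word_eval G S w \<in> carrier G"
      using G w by (simp add: word_eval_closed free_group_def)
    moreover have "inj_on h (carrier G)" using h(1) by (simp add: iso_def bij_betw_def)
    ultimately show "word_eval G S w = \<one>\<^bsub>G\<^esub> \<longleftrightarrow> word_eval H T w = \<one>\<^bsub>H\<^esub>"
      by (metis h.hom_one h.G.one_closed inj_onD)
  qed
next
  assume R: ?R
  interpret F: group "free_group k" by (rule free_group_group)
  let ?F = "carrier (free_group k)"
  have eq: "word_eval G S u = word_eval G S v \<longleftrightarrow> word_eval H T u = word_eval H T v"
    if "u \<in> ?F" "v \<in> ?F" for u v
    using that R word_eval_eq_iff[OF G that] word_eval_eq_iff[OF H that] by simp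
  define h where "h g = word_eval H T (SOME w. w \<in> ?F \<and> word_eval G S w = g)" for g
  have h: "h (word_eval G S w) = word_eval H T w" if "w \<in> ?F" for w
  proof -
    have "(SOME v. v \<in> ?F \<and> word_eval G S v = word_eval G S w) \<in> ?F \<and>
          word_eval G S (SOME v. v \<in> ?F \<and> word_eval G S v = word_eval G S w) = word_eval G S w"
      by (rule someI) (use that in blast)
    then show ?thesis unfolding h_def using eq that by blast
  qed
  have surjG: "carrier G = word_eval G S ` ?F" and surjH: "carrier H = word_eval H T ` ?F"
    using word_eval_surj G H by blast+
  have "h \<in> hom G H"
  proof (rule homI)
    fix x assume "x \<in> carrier G"
    then show "h x \<in> carrier H" unfolding surjG surjH using h by auto
  next
    fix x y assume "x \<in> carrier G" "y \<in> carrier G"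
    then obtain u v where uv: "u \<in> ?F" "v \<in> ?F" "x = word_eval G S u" "y = word_eval G S v"
      unfolding surjG by (elim imageE) auto
    then have "h (x \<otimes>\<^bsub>G\<^esub> y) = h (word_eval G S (u \<otimes>\<^bsub>free_group k\<^esub> v))"
      using hom_mult[OF word_eval_hom[OF G]] by simp
    also have "\<dots> = h x \<otimes>\<^bsub>H\<^esub> h y"
      using uv h hom_mult[OF word_eval_hom[OF H]] by simp
    finally show "h (x \<otimes>\<^bsub>G\<^esub> y) = h x \<otimes>\<^bsub>H\<^esub> h y" .
  qed
  moreover have "bij_betw h (carrier G) (carrier H)"
  proof (rule bij_betw_imageI)
    show "inj_on h (carrier G)" unfolding surjG using h eq by (auto simp: inj_on_def)
    show "h ` carrier G = carrier H" unfolding surjG surjH image_image using h by (intro image_cong) auto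
  qed
  moreover have "map h S = T"
  proof (rule nth_equalityI)
    show "length (map h S) = length T" using G H by (simp add: marked_group_def)
    fix i assume "i < length (map h S)"
    then have i: "i < k" "S ! i \<in> carrier G" "T ! i \<in> carrier H" "i < length S"
      using G H by (auto simp: marked_group_def)
    then have "[(i, True)] \<in> ?F" by (simp add: free_group_def reduced_word_def)
    from h[OF this] show "map h S ! i = T ! i"
      using G H i by (simp add: letter_eval_def marked_group_def group.is_monoid)
  qed
  ultimately show ?L by (auto simp: marked_iso_def iso_def)
qed

lemma equiv_marked_iso_rel: "equiv {(G, S). marked_group k G S} (marked_iso_rel k)"
  by (rule equivI) (auto simp: refl_on_def sym_def trans_def marked_iso_rel_def marked_iso_iff)

lemma trivial_word_class:
  assumes "marked_group k G S" "w \<in> carrier (free_group k)"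
  shows "trivial_word (marked_iso_rel k `` {(G, S)}) w \<longleftrightarrow> word_eval G S w = \<one>\<^bsub>G\<^esub>"
proof
  assume "word_eval G S w = \<one>\<^bsub>G\<^esub>"
  moreover have "(G, S) \<in> marked_iso_rel k `` {(G, S)}"
    using assms by (simp add: marked_iso_rel_def marked_iso_iff)
  ultimately show "trivial_word (marked_iso_rel k `` {(G, S)}) w"
    unfolding trivial_word_def by blast
next
  assume "trivial_word (marked_iso_rel k `` {(G, S)}) w"
  then obtain H :: "letter list set monoid" and T
    where "marked_group k H T" "marked_iso G S H T" "word_eval H T w = \<one>\<^bsub>H\<^esub>"
    by (auto simp: trivial_word_def marked_iso_rel_def)
  then show "word_eval G S w = \<one>\<^bsub>G\<^esub>"
    using assms marked_iso_iff[of k G S H T] by metis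
qed

lemma marked_groups_eq_iff:
  assumes "X \<in> marked_groups k" "Y \<in> marked_groups k"
  shows "X = Y \<longleftrightarrow> (\<forall>w\<in>carrier (free_group k). trivial_word X w \<longleftrightarrow> trivial_word Y w)"
proof -
  obtain G S H T where *: "marked_group k G S" "X = marked_iso_rel k `` {(G, S)}"
      "marked_group k H T" "Y = marked_iso_rel k `` {(H, T)}"
    using assms by (auto simp: marked_groups_def elim!: quotientE)
  have "X = Y \<longleftrightarrow> ((G, S), (H, T)) \<in> marked_iso_rel k"
    unfolding * by (rule eq_equiv_class_iff[OF equiv_marked_iso_rel]) (use * in auto)
  also have "\<dots> \<longleftrightarrow> (\<forall>w\<in>carrier (free_group k). trivial_word X w \<longleftrightarrow> trivial_word Y w)"
    unfolding *(2,4) using *(1,3) by (simp add: trivial_word_class) (simp add: marked_iso_rel_def marked_iso_iff)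
  finally show ?thesis .
qed

lemma marked_dist_le_iff:
  assumes "X \<in> marked_groups k" "Y \<in> marked_groups k"
  shows "marked_dist k X Y \<le> exp (- real n) \<longleftrightarrow>
         (\<forall>w\<in>carrier (free_group k). length w < n \<longrightarrow> trivial_word X w = trivial_word Y w)"
proof (cases "X = Y")
  case False
  define P where
    "P l \<longleftrightarrow> (\<exists>w\<in>carrier (free_group k). length w = l \<and> trivial_word X w \<noteq> trivial_word Y w)" for l
  have d: "marked_dist k X Y = exp (- real (Least P))"
    using False by (simp add: marked_dist_def P_def [abs_def])
  have "\<exists>l. P l" using False marked_groups_eq_iff[OF assms] unfolding P_def by blast
  then have "P (Least P)" by (rule LeastI_ex)
  then have "n \<le> Least P \<longleftrightarrow> (\<forall>l<n. \<not> P l)"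
    using not_less_Least[of _ P] by (meson leI less_le_trans)
  also have "\<dots> \<longleftrightarrow> (\<forall>w\<in>carrier (free_group k). length w < n \<longrightarrow> trivial_word X w = trivial_word Y w)"
    unfolding P_def by blast
  finally show ?thesis by (simp only: d exp_le_cancel_iff neg_le_iff_le of_nat_le_iff)
qed (simp add: marked_dist_def)

lemma marked_dist_nonneg: "marked_dist k X Y \<ge> 0"
  by (simp add: marked_dist_def)

lemma marked_dist_exp: "X \<noteq> Y \<Longrightarrow> \<exists>p. marked_dist k X Y = exp (- real p)"
  unfolding marked_dist_def by (simp only: if_False) blast

lemma marked_dist_commute: "marked_dist k X Y = marked_dist k Y X"
proof -
  have "(trivial_word X w \<noteq> trivial_word Y w) = (trivial_word Y w \<noteq> trivial_word X w)" for w
    by blast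
  then show ?thesis unfolding marked_dist_def eq_commute[of X Y] by (simp only:)
qed

lemma Metric_space_marked: "Metric_space (marked_groups k) (marked_dist k)"
proof (rule Metric_space.intro)
  show "0 \<le> marked_dist k X Y" for X Y by (rule marked_dist_nonneg)
  show "marked_dist k X Y = marked_dist k Y X" for X Y by (rule marked_dist_commute)
  show "marked_dist k X Y = 0 \<longleftrightarrow> X = Y" for X Y
  proof (cases "X = Y")
    case False
    with marked_dist_exp[OF False, of k] show ?thesis by (metis exp_not_eq_zero)
  qed (simp add: marked_dist_def)
  fix X Y Z assume XYZ: "X \<in> marked_groups k" "Y \<in> marked_groups k" "Z \<in> marked_groups k"
  show "marked_dist k X Z \<le> marked_dist k X Y + marked_dist k Y Z"
  proof (cases "X = Y \<or> Y = Z")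
    case True
    then show ?thesis using marked_dist_nonneg[of k] by (elim disjE) (simp_all only: le_add_same_cancel1 le_add_same_cancel2)
  next
    case False
    then obtain p q where pq: "marked_dist k X Y = exp (- real p)" "marked_dist k Y Z = exp (- real q)"
      using marked_dist_exp by metis
    define r where "r = min p q"
    have "marked_dist k X Y \<le> exp (- real r)" "marked_dist k Y Z \<le> exp (- real r)"
      unfolding pq by (simp_all add: r_def)
    then have "marked_dist k X Z \<le> exp (- real r)"
      unfolding marked_dist_le_iff[OF XYZ(1,2)] marked_dist_le_iff[OF XYZ(2,3)]
        marked_dist_le_iff[OF XYZ(1,3)] by blast
    also have "\<dots> \<le> exp (- real p) + exp (- real q)"
      by (cases "p \<le> q") (simp_all add: r_def min_def)
    finally show ?thesis unfolding pq .
  qed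
qed

lemma marked_group_quotient:
  assumes "N \<lhd> free_group k"
  shows "marked_group k (free_group k Mod N) (map (\<lambda>i. N #>\<^bsub>free_group k\<^esub> free_gen i) [0..<k])"
    (is "marked_group k ?Q ?S")
proof -
  interpret N: normal N "free_group k" by fact
  interpret Q: group ?Q by (rule N.factorgroup_is_group)
  have gen: "free_gen i \<in> carrier (free_group k)" if "i < k" for i
    using that by (simp add: free_group_def reduced_word_def)
  have cQ: "carrier ?Q = rcosets\<^bsub>free_group k\<^esub> N" by (simp add: FactGroup_def)
  have cos: "N #>\<^bsub>free_group k\<^esub> w \<in> carrier ?Q" if "w \<in> carrier (free_group k)" for w
    unfolding cQ using N.rcosetsI[OF N.subset that] .
  have S: "set ?S \<subseteq> carrier ?Q"
  proof
    fix s assume "s \<in> set ?S"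
    then obtain i where "i < k" "s = N #>\<^bsub>free_group k\<^esub> free_gen i" by auto
    then show "s \<in> carrier ?Q" using cos[OF gen] by simp
  qed
  have letter: "N #>\<^bsub>free_group k\<^esub> [x] \<in> generate ?Q (set ?S)" if "fst x < k" for x
  proof (cases "snd x")
    case True
    then have "x = (fst x, True)" by (simp add: prod_eq_iff)
    then show ?thesis using that by (intro generate.incl) (auto intro!: image_eqI[of _ _ "fst x"])
  next
    case False
    then have x: "x = (fst x, False)" by (simp add: prod_eq_iff)
    have "inv\<^bsub>free_group k\<^esub> (free_gen (fst x)) = [x]"
      by (rule N.inv_equality)
         (subst x, use that in \<open>auto simp: free_group_def reduced_word_def inv_letter_def\<close>)+
    then have "N #>\<^bsub>free_group k\<^esub> [x] = inv\<^bsub>?Q\<^esub> (N #>\<^bsub>free_group k\<^esub> free_gen (fst x))"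
      using N.rcos_inv[OF gen[OF that]] N.inv_FactGroup[OF cos[OF gen[OF that]]] by simp
    then show ?thesis using that by (auto intro!: generate.inv)
  qed
  have "N #>\<^bsub>free_group k\<^esub> w \<in> generate ?Q (set ?S)" if "w \<in> carrier (free_group k)" for w
    using that
  proof (induction w)
    case Nil
    have "N #>\<^bsub>free_group k\<^esub> \<one>\<^bsub>free_group k\<^esub> = \<one>\<^bsub>?Q\<^esub>"
      using N.subset by (simp add: N.coset_mult_one FactGroup_def)
    then show ?case using generate.one[of ?Q] by (simp add: free_group_def)
  next
    case (Cons x w)
    then have x: "fst x < k" "[x] \<in> carrier (free_group k)" and w: "w \<in> carrier (free_group k)"
      by (auto simp: free_group_def reduced_Cons)
    have "[x] \<otimes>\<^bsub>free_group k\<^esub> w = x # w"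
      using Cons.prems by (simp add: free_group_def red_cons_reduced)
    then have "N #>\<^bsub>free_group k\<^esub> (x # w) =
               (N #>\<^bsub>free_group k\<^esub> [x]) \<otimes>\<^bsub>?Q\<^esub> (N #>\<^bsub>free_group k\<^esub> w)"
      using N.rcos_sum[OF x(2) w] by (simp add: FactGroup_def)
    then show ?case using letter[OF x(1)] Cons.IH[OF w] generate.eng by metis
  qed
  then have "carrier ?Q \<subseteq> generate ?Q (set ?S)" unfolding cQ RCOSETS_def by blast
  then have "generate ?Q (set ?S) = carrier ?Q" using Q.generate_incl[OF S] by blast
  then show ?thesis using S Q.is_group unfolding marked_group_def by simp
qed

theorem marked_group_universe:
  fixes G :: "'a monoid"
  assumes "marked_group k G S"
  shows "\<exists>(H :: letter list set monoid) T. marked_group k H T \<and> marked_iso G S H T"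
proof -
  interpret G: group G using assms by (simp add: marked_group_def)
  interpret h: group_hom "free_group k" G "word_eval G S"
    using assms by (simp add: group_hom_def group_hom_axioms_def word_eval_hom free_group_group G.is_group)
  let ?N = "kernel (free_group k) G (word_eval G S)"
  let ?Q = "free_group k Mod ?N"
  let ?T = "map (\<lambda>i. ?N #>\<^bsub>free_group k\<^esub> free_gen i) [0..<k]"
  interpret N: normal ?N "free_group k" by (rule h.normal_kernel)
  let ?f = "\<lambda>X. the_elem (word_eval G S ` X)"
  have T: "marked_group k ?Q ?T" by (rule marked_group_quotient[OF h.normal_kernel])
  have f: "?f \<in> iso ?Q G" by (rule h.FactGroup_iso_set[OF word_eval_surj[OF assms]])
  have "map ?f ?T = S"
  proof (rule nth_equalityI)
    fix i assume "i < length (map ?f ?T)"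
    then have i: "i < k" "S ! i \<in> carrier G" using assms by (auto simp: marked_group_def)
    then have gen: "free_gen i \<in> carrier (free_group k)"
      by (simp add: free_group_def reduced_word_def)
    have "word_eval G S ` (?N #>\<^bsub>free_group k\<^esub> free_gen i) = {S ! i}"
    proof
      show "word_eval G S ` (?N #>\<^bsub>free_group k\<^esub> free_gen i) \<subseteq> {S ! i}"
      proof (intro image_subsetI, unfold singleton_iff)
        fix x assume "x \<in> ?N #>\<^bsub>free_group k\<^esub> free_gen i"
        then have "\<exists>n\<in>?N. x = n \<otimes>\<^bsub>free_group k\<^esub> free_gen i"
          unfolding r_coset_def by blast
        then obtain n where n: "n \<in> ?N" "x = n \<otimes>\<^bsub>free_group k\<^esub> free_gen i" ..
        then have n': "n \<in> carrier (free_group k)" "word_eval G S n = \<one>\<^bsub>G\<^esub>"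
          unfolding kernel_def by simp_all
        have "word_eval G S x = word_eval G S n \<otimes>\<^bsub>G\<^esub> word_eval G S (free_gen i)"
          unfolding n(2) by (rule hom_mult[OF word_eval_hom[OF assms] n'(1) gen])
        then show "word_eval G S x = S ! i" using i n'(2) by (simp add: letter_eval_def)
      qed
      have "free_gen i \<in> ?N #>\<^bsub>free_group k\<^esub> free_gen i" by (rule group.rcos_self[OF free_group_group gen N.subgroup_axioms])
      moreover have "word_eval G S (free_gen i) = S ! i" using i by (simp add: letter_eval_def)
      ultimately show "{S ! i} \<subseteq> word_eval G S ` (?N #>\<^bsub>free_group k\<^esub> free_gen i)"
        by (metis image_eqI insert_subset empty_subsetI)
    qed
    then show "map ?f ?T ! i = S ! i" using i by simp
  qed (use assms in \<open>simp add: marked_group_def\<close>)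
  with f have "marked_iso ?Q ?T G S" by (auto simp: marked_iso_def)
  then have "marked_iso G S ?Q ?T" using marked_iso_iff[OF T assms] marked_iso_iff[OF assms T] by auto
  with T show ?thesis by blast
qed

lemma normal_closure_normal:
  assumes "group G" "R \<subseteq> carrier G"
  shows "normal_closure G R \<lhd> G"
proof -
  interpret group G by fact
  have "carrier G \<lhd> G" by (rule normal_invI) (auto intro: subgroup_self)
  then have c: "carrier G \<in> {N. N \<lhd> G \<and> R \<subseteq> N}" using assms by simp
  have "subgroup (normal_closure G R) G"
    unfolding normal_closure_def using c
    by (intro subgroups_Inter) (auto intro: normal_imp_subgroup)
  then show ?thesis
    by (rule normal_invI) (auto simp: normal_closure_def intro: normal.inv_op_closed2)
qed

lemma BS_in_marked_groups: "BS m n \<in> marked_groups 2"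
proof -
  interpret F: group "free_group 2" by (rule free_group_group)
  have "free_gen i \<in> carrier (free_group 2)" if "i < 2" for i
    using that by (simp add: free_group_def reduced_word_def)
  then have "BS_relator m n \<in> carrier (free_group 2)" by (simp add: BS_relator_def Let_def)
  then have "marked_group 2 (presented_group 2 {BS_relator m n}) (presented_marking 2 {BS_relator m n})"
    unfolding presented_group_def presented_marking_def
    by (intro marked_group_quotient normal_closure_normal F.is_group) simp
  then show ?thesis unfolding BS_def marked_groups_def by (intro quotientI) simp
qed

lemma madic_abs_le_iff:
  assumes "\<bar>m\<bar> \<ge> 2"
  shows "madic_abs m x \<le> 1 / real_of_int \<bar>m\<bar> ^ h \<longleftrightarrow> m ^ h dvd x"
proof (cases "x = 0")
  case False
  have m: "\<not> is_unit m" using assms by auto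
  have "m ^ h dvd x \<longleftrightarrow> h \<le> multiplicity m x"
    using False m by (intro power_dvd_iff_le_multiplicity finite_divisor_powers)
  also have "\<dots> \<longleftrightarrow> real_of_int \<bar>m\<bar> ^ h \<le> real_of_int \<bar>m\<bar> ^ multiplicity m x"
    using assms by (subst power_increasing_iff) auto
  also have "\<dots> \<longleftrightarrow> madic_abs m x \<le> 1 / real_of_int \<bar>m\<bar> ^ h"
    unfolding madic_abs_def using False assms by (simp add: frac_le_eq divide_le_cancel field_simps)
  finally show ?thesis by blast
qed (use assms in \<open>auto simp: madic_abs_def\<close>)

lemma Metric_space_madic:
  assumes "\<bar>m\<bar> \<ge> 2"
  shows "Metric_space UNIV (madic_dist m)"
proof (rule Metric_space.intro)
  have nonneg: "0 \<le> madic_dist m x y" for x y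
    by (simp add: madic_dist_def madic_abs_def)
  show "0 \<le> madic_dist m x y" for x y by (rule nonneg)
  have minus: "multiplicity m (x - y) = multiplicity m (y - x)" for x y
    by (simp add: multiplicity_def dvd_diff_commute)
  show "madic_dist m x y = madic_dist m y x" for x y
    by (auto simp: madic_dist_def madic_abs_def minus[of x y])
  show "madic_dist m x y = 0 \<longleftrightarrow> x = y" for x y
    using assms by (auto simp: madic_dist_def madic_abs_def)
  fix x y z :: int
  have pow: "madic_dist m x y = 0 \<or> (\<exists>h. madic_dist m x y = 1 / real_of_int \<bar>m\<bar> ^ h)" for x y
    by (auto simp: madic_dist_def madic_abs_def)
  have le: "madic_dist m x y \<le> 1 / real_of_int \<bar>m\<bar> ^ h \<longleftrightarrow> m ^ h dvd x - y" for x y h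
    unfolding madic_dist_def by (rule madic_abs_le_iff[OF assms])
  have "madic_dist m x z \<le> max (madic_dist m x y) (madic_dist m y z)"
  proof (cases "x = y \<or> y = z")
    case False
    define r where "r = max (madic_dist m x y) (madic_dist m y z)"
    have "madic_dist m x y \<noteq> 0" "madic_dist m y z \<noteq> 0"
      using False assms by (auto simp: madic_dist_def madic_abs_def)
    then obtain h where h: "r = 1 / real_of_int \<bar>m\<bar> ^ h"
      unfolding r_def max_def using pow[of x y] pow[of y z] by meson
    have "madic_dist m x y \<le> r" "madic_dist m y z \<le> r" by (simp_all add: r_def)
    then have "m ^ h dvd x - y" "m ^ h dvd y - z" unfolding h le .
    then have "m ^ h dvd (x - y) + (y - z)" by (rule dvd_add)
    then show ?thesis using le[of x z h] h r_def by simp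
  qed auto
  also have "\<dots> \<le> madic_dist m x y + madic_dist m y z"
    using nonneg[of x y] nonneg[of y z] by simp
  finally show "madic_dist m x z \<le> madic_dist m x y + madic_dist m y z" .
qed

lemma madic_Cauchy_convergent:
  assumes "\<bar>m\<bar> \<ge> 2" "x \<in> madic_Cauchy m" "y \<in> madic_Cauchy m"
  shows "convergent (\<lambda>i. madic_dist m (x i) (y i))"
proof -
  interpret Metric_space UNIV "madic_dist m" by (rule Metric_space_madic) fact
  have "Cauchy (\<lambda>i. madic_dist m (x i) (y i))"
  proof (rule metric_CauchyI)
    fix e :: real assume "e > 0"
    then obtain N1 N2 where
      N1: "\<And>i j. N1 \<le> i \<Longrightarrow> N1 \<le> j \<Longrightarrow> madic_dist m (x i) (x j) < e / 2" and
      N2: "\<And>i j. N2 \<le> i \<Longrightarrow> N2 \<le> j \<Longrightarrow> madic_dist m (y i) (y j) < e / 2"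
      using assms(2,3) unfolding madic_Cauchy_def MCauchy_def mem_Collect_eq
      by (meson half_gt_zero)
    show "\<exists>M. \<forall>i\<ge>M. \<forall>j\<ge>M. dist (madic_dist m (x i) (y i)) (madic_dist m (x j) (y j)) < e"
    proof (intro exI allI impI)
      fix i j assume ij: "max N1 N2 \<le> i" "max N1 N2 \<le> j"
      have "madic_dist m (x i) (x j) < e / 2" "madic_dist m (y i) (y j) < e / 2"
        using ij N1[of i j] N2[of i j] by auto
      moreover have
        "madic_dist m (x i) (y i) \<le> madic_dist m (x i) (x j) + (madic_dist m (x j) (y j) + madic_dist m (y j) (y i))"
        "madic_dist m (x j) (y j) \<le> madic_dist m (x j) (x i) + (madic_dist m (x i) (y i) + madic_dist m (y i) (y j))"
        using triangle[of "x i" "x j" "y i"] triangle[of "x j" "y j" "y i"]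
              triangle[of "x j" "x i" "y j"] triangle[of "x i" "y i" "y j"] by auto
      moreover have "madic_dist m (x j) (x i) = madic_dist m (x i) (x j)"
        "madic_dist m (y j) (y i) = madic_dist m (y i) (y j)" by (rule commute)+
      ultimately show "dist (madic_dist m (x i) (y i)) (madic_dist m (x j) (y j)) < e"
        unfolding dist_real_def by linarith
    qed
  qed
  then show ?thesis by (simp add: Cauchy_convergent_iff)
qed

lemma equiv_madic_rel:
  assumes "\<bar>m\<bar> \<ge> 2"
  shows "equiv (madic_Cauchy m) (madic_rel m)"
proof -
  interpret Metric_space UNIV "madic_dist m" by (rule Metric_space_madic) fact
  show ?thesis
  proof (rule equivI)
    show "madic_rel m \<subseteq> madic_Cauchy m \<times> madic_Cauchy m" by (auto simp: madic_rel_def)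
    show "refl_on (madic_Cauchy m) (madic_rel m)" by (auto simp: refl_on_def madic_rel_def)
    show "sym (madic_rel m)" by (auto simp: sym_def madic_rel_def commute)
    show "trans (madic_rel m)"
    proof (rule transI)
      fix x y z assume xy: "(x, y) \<in> madic_rel m" and yz: "(y, z) \<in> madic_rel m"
      have "(\<lambda>i. madic_dist m (x i) (y i) + madic_dist m (y i) (z i)) \<longlonglongrightarrow> 0 + 0"
        using xy yz by (intro tendsto_add) (auto simp: madic_rel_def)
      then have "(\<lambda>i. madic_dist m (x i) (y i) + madic_dist m (y i) (z i)) \<longlonglongrightarrow> 0" by simp
      then have "(\<lambda>i. madic_dist m (x i) (z i)) \<longlonglongrightarrow> 0"
        by (rule tendsto_sandwich[OF _ _ tendsto_const, rotated 2]) (auto simp: triangle)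
      then show "(x, z) \<in> madic_rel m" using xy yz by (simp add: madic_rel_def)
    qed
  qed
qed

lemma madic_int_dist_class:
  assumes "\<bar>m\<bar> \<ge> 2" "x \<in> madic_Cauchy m" "y \<in> madic_Cauchy m"
  shows "(\<lambda>i. madic_dist m (x i) (y i)) \<longlonglongrightarrow> madic_int_dist m (madic_class m x) (madic_class m y)"
proof -
  interpret Metric_space UNIV "madic_dist m" by (rule Metric_space_madic) fact
  obtain d where d: "(\<lambda>i. madic_dist m (x i) (y i)) \<longlonglongrightarrow> d"
    using madic_Cauchy_convergent[OF assms] by (auto simp: convergent_def)
  have all: "(\<lambda>i. madic_dist m (x' i) (y' i)) \<longlonglongrightarrow> d"
    if "x' \<in> madic_class m x" "y' \<in> madic_class m y" for x' y'
  proof (rule LIM_zero_cancel, rule Lim_null_comparison)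
    let ?b = "\<lambda>i. madic_dist m (x i) (x' i) + madic_dist m (y i) (y' i) + \<bar>madic_dist m (x i) (y i) - d\<bar>"
    have "?b \<longlonglongrightarrow> 0 + 0 + \<bar>d - d\<bar>"
      using that by (intro tendsto_intros d) (auto simp: madic_class_def madic_rel_def)
    then show "?b \<longlonglongrightarrow> 0" by simp
    have "norm (madic_dist m (x' i) (y' i) - d) \<le> ?b i" for i
      using triangle[of "x' i" "x i" "y' i"] triangle[of "x i" "y i" "y' i"]
        triangle[of "x i" "x' i" "y i"] triangle[of "x' i" "y' i" "y i"]
        commute[of "x i" "x' i"] commute[of "y i" "y' i"] by (simp add: abs_if)
    then show "\<forall>\<^sub>F i in sequentially. norm (madic_dist m (x' i) (y' i) - d) \<le> ?b i" by simp
  qed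
  have x: "x \<in> madic_class m x" and y: "y \<in> madic_class m y"
    using equiv_class_self[OF equiv_madic_rel[OF assms(1)]] assms(2,3) by (auto simp: madic_class_def)
  have "madic_class m x \<in> carrier (madic_ring m)" "madic_class m y \<in> carrier (madic_ring m)"
    using assms(2,3) by (auto simp: madic_class_def madic_ring_def quotientI)
  then have "madic_int_dist m (madic_class m x) (madic_class m y) =
    (THE d. \<forall>x'\<in>madic_class m x. \<forall>y'\<in>madic_class m y. (\<lambda>i. madic_dist m (x' i) (y' i)) \<longlonglongrightarrow> d)"
    by (simp add: madic_int_dist_def)
  also have "\<dots> = d"
  proof (rule the_equality)
    show "d' = d" if "\<forall>x'\<in>madic_class m x. \<forall>y'\<in>madic_class m y. (\<lambda>i. madic_dist m (x' i) (y' i)) \<longlonglongrightarrow> d'" for d'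
      using that x y d LIMSEQ_unique by blast
  qed (use all in blast)
  finally show ?thesis using d by simp
qed

lemma madic_carrierE:
  assumes "X \<in> carrier (madic_ring m)"
  obtains x where "x \<in> madic_Cauchy m" "X = madic_class m x"
  using assms by (auto simp: madic_ring_def madic_class_def elim: quotientE)

lemma Metric_space_madic_int:
  assumes "\<bar>m\<bar> \<ge> 2"
  shows "Metric_space (carrier (madic_ring m)) (madic_int_dist m)"
proof (rule Metric_space.intro)
  interpret Metric_space UNIV "madic_dist m" by (rule Metric_space_madic) fact
  note lim = madic_int_dist_class[OF assms]
  show "0 \<le> madic_int_dist m X Y" for X Y
  proof (cases "X \<in> carrier (madic_ring m) \<and> Y \<in> carrier (madic_ring m)")
    case True
    then obtain x y where "x \<in> madic_Cauchy m" "X = madic_class m x"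
      "y \<in> madic_Cauchy m" "Y = madic_class m y" by (metis madic_carrierE)
    then show ?thesis using LIMSEQ_le_const[OF lim[of x y]] nonneg by blast
  qed (auto simp: madic_int_dist_def)
  show "madic_int_dist m X Y = madic_int_dist m Y X" for X Y
  proof (cases "X \<in> carrier (madic_ring m) \<and> Y \<in> carrier (madic_ring m)")
    case True
    then obtain x y where "x \<in> madic_Cauchy m" "X = madic_class m x"
      "y \<in> madic_Cauchy m" "Y = madic_class m y" by (metis madic_carrierE)
    moreover have "(\<lambda>i. madic_dist m (x i) (y i)) = (\<lambda>i. madic_dist m (y i) (x i))"
      by (intro ext commute)
    ultimately show ?thesis using lim[of x y] lim[of y x] LIMSEQ_unique by metis
  qed (auto simp: madic_int_dist_def)
  fix X Y assume XY: "X \<in> carrier (madic_ring m)" "Y \<in> carrier (madic_ring m)"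
  then obtain x y where xy: "x \<in> madic_Cauchy m" "X = madic_class m x"
      "y \<in> madic_Cauchy m" "Y = madic_class m y" by (metis madic_carrierE)
  have "X = Y \<longleftrightarrow> (x, y) \<in> madic_rel m"
    unfolding xy madic_class_def by (rule eq_equiv_class_iff[OF equiv_madic_rel[OF assms] xy(1,3)])
  also have "\<dots> \<longleftrightarrow> (\<lambda>i. madic_dist m (x i) (y i)) \<longlonglongrightarrow> 0"
    using xy by (simp add: madic_rel_def)
  also have "\<dots> \<longleftrightarrow> madic_int_dist m X Y = 0"
    using lim[OF xy(1,3)] LIMSEQ_unique unfolding xy by metis
  finally show "madic_int_dist m X Y = 0 \<longleftrightarrow> X = Y" by blast
  fix Z assume "Z \<in> carrier (madic_ring m)"
  then obtain z where z: "z \<in> madic_Cauchy m" "Z = madic_class m z" by (metis madic_carrierE)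
  show "madic_int_dist m X Z \<le> madic_int_dist m X Y + madic_int_dist m Y Z"
    unfolding xy z
    by (rule LIMSEQ_le[OF lim[OF xy(1) z(1)] tendsto_add[OF lim[OF xy(1,3)] lim[OF xy(3) z(1)]]])
       (auto simp: triangle)
qed

lemma madic_dist_op_le:
  assumes "\<bar>m\<bar> \<ge> 2"
  shows "madic_dist m (x + y) (x' + y') \<le> madic_dist m x x' + madic_dist m y y'"
    and "madic_dist m (x * y) (x' * y') \<le> madic_dist m x x' + madic_dist m y y'"
proof -
  interpret Metric_space UNIV "madic_dist m" by (rule Metric_space_madic) fact
  have transl: "madic_dist m (z + x) (z + y) = madic_dist m x y" for x y z
    by (simp add: madic_dist_def)
  have le: "madic_dist m x y \<le> 1 / real_of_int \<bar>m\<bar> ^ h \<longleftrightarrow> m ^ h dvd x - y" for x y h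
    unfolding madic_dist_def by (rule madic_abs_le_iff[OF assms])
  have mul: "madic_dist m (z * x) (z * y) \<le> madic_dist m x y" for x y z
  proof (cases "x = y")
    case False
    then obtain h where h: "madic_dist m x y = 1 / real_of_int \<bar>m\<bar> ^ h"
      by (auto simp: madic_dist_def madic_abs_def)
    then have "m ^ h dvd x - y" using le[of x y h] by simp
    then show ?thesis unfolding h le by (simp add: right_diff_distrib[symmetric])
  qed simp
  show "madic_dist m (x + y) (x' + y') \<le> madic_dist m x x' + madic_dist m y y'"
    using triangle[of "x + y" "x' + y" "x' + y'"] transl[of y x x'] transl[of x' y y']
    by (simp add: add.commute)
  show "madic_dist m (x * y) (x' * y') \<le> madic_dist m x x' + madic_dist m y y'"
    using triangle[of "x * y" "x' * y" "x' * y'"] mul[of y x x'] mul[of x' y y']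
    by (simp add: mult.commute)
qed

lemma madic_Cauchy_op:
  assumes "\<bar>m\<bar> \<ge> 2"
    and f: "\<And>a b a' b'. madic_dist m (f a b) (f a' b') \<le> madic_dist m a a' + madic_dist m b b'"
  shows "x \<in> madic_Cauchy m \<Longrightarrow> y \<in> madic_Cauchy m \<Longrightarrow> (\<lambda>i. f (x i) (y i)) \<in> madic_Cauchy m"
    and "(x, x') \<in> madic_rel m \<Longrightarrow> (y, y') \<in> madic_rel m \<Longrightarrow>
         (\<lambda>i. f (x i) (y i), \<lambda>i. f (x' i) (y' i)) \<in> madic_rel m"
proof -
  interpret Metric_space UNIV "madic_dist m" by (rule Metric_space_madic) fact
  show C: "(\<lambda>i. f (x i) (y i)) \<in> madic_Cauchy m"
    if xy: "x \<in> madic_Cauchy m" "y \<in> madic_Cauchy m" for x y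
    unfolding madic_Cauchy_def MCauchy_def mem_Collect_eq
  proof (intro conjI allI impI)
    fix e :: real assume "e > 0"
    then obtain N1 N2 where
      N1: "\<And>i j. N1 \<le> i \<Longrightarrow> N1 \<le> j \<Longrightarrow> madic_dist m (x i) (x j) < e / 2" and
      N2: "\<And>i j. N2 \<le> i \<Longrightarrow> N2 \<le> j \<Longrightarrow> madic_dist m (y i) (y j) < e / 2"
      using xy unfolding madic_Cauchy_def MCauchy_def mem_Collect_eq
      by (meson half_gt_zero)
    show "\<exists>N. \<forall>i j. N \<le> i \<longrightarrow> N \<le> j \<longrightarrow> madic_dist m (f (x i) (y i)) (f (x j) (y j)) < e"
    proof (intro exI allI impI)
      fix i j assume "max N1 N2 \<le> i" "max N1 N2 \<le> j"
      then show "madic_dist m (f (x i) (y i)) (f (x j) (y j)) < e"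
        using N1[of i j] N2[of i j] f[of "x i" "y i" "x j" "y j"] by auto
    qed
  qed simp
  show "(\<lambda>i. f (x i) (y i), \<lambda>i. f (x' i) (y' i)) \<in> madic_rel m"
    if xy: "(x, x') \<in> madic_rel m" "(y, y') \<in> madic_rel m"
  proof -
    have "(\<lambda>i. madic_dist m (x i) (x' i) + madic_dist m (y i) (y' i)) \<longlonglongrightarrow> 0 + 0"
      using xy by (intro tendsto_add) (auto simp: madic_rel_def)
    then have "(\<lambda>i. madic_dist m (x i) (x' i) + madic_dist m (y i) (y' i)) \<longlonglongrightarrow> 0" by simp
    then have "(\<lambda>i. madic_dist m (f (x i) (y i)) (f (x' i) (y' i))) \<longlonglongrightarrow> 0"
      by (rule tendsto_sandwich[OF _ _ tendsto_const, rotated 2]) (auto simp: f)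
    then show ?thesis using xy C by (simp add: madic_rel_def)
  qed
qed

lemma madic_class_op:
  assumes "\<bar>m\<bar> \<ge> 2"
    and f: "\<And>a b a' b'. madic_dist m (f a b) (f a' b') \<le> madic_dist m a a' + madic_dist m b b'"
    and "x \<in> madic_Cauchy m" "y \<in> madic_Cauchy m"
  shows "(\<Union>x\<in>madic_class m x. \<Union>y\<in>madic_class m y. madic_class m (\<lambda>i. f (x i) (y i))) =
         madic_class m (\<lambda>i. f (x i) (y i))"
proof -
  have E: "equiv (madic_Cauchy m) (madic_rel m)" by (rule equiv_madic_rel) fact
  have x: "x \<in> madic_class m x" and y: "y \<in> madic_class m y"
    using equiv_class_self[OF E] assms(3,4) by (auto simp: madic_class_def)
  have "madic_class m (\<lambda>i. f (x' i) (y' i)) = madic_class m (\<lambda>i. f (x i) (y i))"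
    if "x' \<in> madic_class m x" "y' \<in> madic_class m y" for x' y'
    unfolding madic_class_def
    by (rule equiv_class_eq[OF E, symmetric], rule madic_Cauchy_op(2)[OF assms(1) f])
       (use that in \<open>auto simp: madic_class_def\<close>)
  then have "(\<Union>x\<in>madic_class m x. \<Union>y\<in>madic_class m y. madic_class m (\<lambda>i. f (x i) (y i))) =
    (\<Union>x'\<in>madic_class m x. \<Union>y'\<in>madic_class m y. madic_class m (\<lambda>i. f (x i) (y i)))"
    by (intro SUP_cong refl) blast
  also have "\<dots> = madic_class m (\<lambda>i. f (x i) (y i))" using x y by blast
  finally show ?thesis .
qed

lemma madic_ring_simps:
  assumes "\<bar>m\<bar> \<ge> 2" "x \<in> madic_Cauchy m" "y \<in> madic_Cauchy m"
  shows "madic_class m x \<oplus>\<^bsub>madic_ring m\<^esub> madic_class m y = madic_class m (\<lambda>i. x i + y i)"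
    and "madic_class m x \<otimes>\<^bsub>madic_ring m\<^esub> madic_class m y = madic_class m (\<lambda>i. x i * y i)"
  using madic_class_op[OF assms(1) madic_dist_op_le(1)[OF assms(1)] assms(2,3)]
    madic_class_op[OF assms(1) madic_dist_op_le(2)[OF assms(1)] assms(2,3)]
  by (simp_all add: madic_ring_def)

lemma madic_class_carrier:
  "x \<in> madic_Cauchy m \<Longrightarrow> madic_class m x \<in> carrier (madic_ring m)"
  by (simp add: madic_class_def madic_ring_def quotientI)

lemma cring_madic_ring:
  assumes m: "\<bar>m\<bar> \<ge> 2"
  shows "cring (madic_ring m)"
proof -
  interpret Metric_space UNIV "madic_dist m" by (rule Metric_space_madic) fact
  let ?R = "madic_ring m" and ?C = "madic_Cauchy m"
  note C = madic_Cauchy_op(1)[OF m madic_dist_op_le(1)[OF m]] madic_Cauchy_op(1)[OF m madic_dist_op_le(2)[OF m]]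
  have const: "(\<lambda>_. n) \<in> ?C" for n
    by (auto simp: madic_Cauchy_def MCauchy_def)
  have one: "\<one>\<^bsub>?R\<^esub> = madic_class m (\<lambda>_. 1)" and zero: "\<zero>\<^bsub>?R\<^esub> = madic_class m (\<lambda>_. 0)"
    by (simp_all add: madic_ring_def madic_of_int_def)
  note simps = madic_ring_simps[OF m] one zero C const madic_class_carrier
  show ?thesis
  proof (rule cringI)
    show "abelian_group ?R"
    proof (rule abelian_groupI)
      show "\<exists>Y\<in>carrier ?R. Y \<oplus>\<^bsub>?R\<^esub> X = \<zero>\<^bsub>?R\<^esub>" if X: "X \<in> carrier ?R" for X
      proof -
        obtain x where x: "x \<in> ?C" "X = madic_class m x" using X by (rule madic_carrierE)
        have "(\<lambda>i. (-1) * x i) \<in> ?C" using C(2)[OF const x(1)] .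
        then show ?thesis using x
          by (intro bexI[of _ "madic_class m (\<lambda>i. (-1) * x i)"]) (simp_all add: simps)
      qed
    qed (auto elim!: madic_carrierE simp: simps algebra_simps)
    show "comm_monoid ?R"
      by (rule comm_monoidI) (auto elim!: madic_carrierE simp: simps algebra_simps)
  qed (auto elim!: madic_carrierE simp: simps algebra_simps)
qed

end

theory Submission
  imports Defs
begin

text \<open>
  The map \<open>BS(m, n) \<mapsto> n\<close> is uniformly continuous for the \<open>m\<close>-adic distance because words of
  bounded length in \<open>BS(m, n)\<close> determine \<open>n\<close> modulo \<open>m ^ h\<close>. In this group \<open>a b\<^sup>m a\<^sup>-\<^sup>1 b\<^sup>-\<^sup>r\<close> is the
  power of \<open>b\<close> with exponent \<open>n - r\<close>. Conjugation by \<open>a\<close> multiplies the exponent by \<open>n / m\<close> as long as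
  \<open>m\<close> divides it; once \<open>m\<close> does not divide it, the conjugate leaves \<open>\<langle>b\<rangle>\<close> and does not even commute with
  \<open>b\<close>. As \<open>n\<close> is prime to \<open>m\<close>, the \<open>h\<close>-fold conjugate of \<open>a b\<^sup>m a\<^sup>-\<^sup>1 b\<^sup>-\<^sup>r\<close> commutes with \<open>b\<close> if and only
  if \<open>m ^ h\<close> divides \<open>n - r\<close> (\<open>trivial_congruence_word_iff\<close>). It suffices to test the residues \<open>r\<close> modulo
  \<open>m ^ h\<close>, hence finitely many words (\<open>short_words_determine_congruence\<close>).

  That these commutators are nontrivial when \<open>m ^ h\<close> does not divide \<open>n - r\<close> would follow from
  Britton's lemma for HNN extensions. The few words in question reduce to \<open>[a b\<^sup>K a\<^sup>-\<^sup>1, b\<^sup>M]\<close> with \<open>m\<close> not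
  dividing \<open>K\<close> and \<open>n\<close> not dividing \<open>M\<close> (\<open>BS_pair_commute_dvd\<close>), and one permutation representation of
  \<open>BS(m, n)\<close> detects all of these (\<open>stable_perm_reduced\<close>).

  The continuous extension sends a limit of groups \<open>BS(m, n\<^sub>i)\<close> to the limit of the Cauchy sequence
  \<open>n\<^sub>i\<close>, which is a unit as the \<open>n\<^sub>i\<close> are prime to \<open>m\<close>. Conversely every unit is a limit of admissible
  integers \<open>n\<^sub>i\<close>, and the space of marked groups is compact (\<open>marked_groups_convergent_subsequence\<close>), so
  that the groups \<open>BS(m, n\<^sub>i)\<close> accumulate at a point over this unit
  (\<open>closure_point_over_madic_limit\<close>). The extension is not injective: admissible integers \<open>n\<^sub>i\<close> may
  converge to an admissible integer \<open>n\<^sub>0\<close> different from all of them, and then the fibre over \<open>n\<^sub>0\<close> contains \<open>BS(m, n\<^sub>0)\<close>, in which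
  \<open>a b\<^sup>m a\<^sup>-\<^sup>1\<close> is the power of \<open>b\<close> with exponent \<open>n\<^sub>0\<close>, and a limit point of the groups
  \<open>BS(m, n\<^sub>i)\<close>, in which it is not.
\<close>

section \<open>Evaluation of words in groups and quotients\<close>

lemma word_eval_generate:
  assumes "group G" "length S = k" "set S \<subseteq> carrier G" "fst ` set w \<subseteq> {..<k}"
  shows "word_eval (G\<lparr>carrier := generate G (set S)\<rparr>) S w = word_eval G S w"
proof -
  interpret group G by fact
  have sub: "subgroup (generate G (set S)) G"
    by (rule generate_is_subgroup) fact
  show ?thesis using assms(4)
  proof (induction w)
    case (Cons x w)
    have "S ! fst x \<in> generate G (set S)"
      using Cons.prems assms(2) by (intro generate.incl) simp
    then show ?case
      using Cons m_inv_consistent[OF sub] by (simp add: letter_eval_def)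
  qed simp
qed

text \<open>Evaluating words is a homomorphism for every tuple of elements, generating or not: the tuple marks
  the subgroup that it generates, and evaluation does not see the difference. This is what makes
  representations of Baumslag--Solitar groups usable without determining their image.\<close>

lemma group_hom_word_eval:
  fixes G (structure)
  assumes "group G" "length S = k" "set S \<subseteq> carrier G"
  shows "group_hom (free_group k) G (word_eval G S)"
proof -
  interpret group G by fact
  let ?H = "G\<lparr>carrier := generate G (set S)\<rparr>"
  have sub: "subgroup (generate G (set S)) G"
    by (rule generate_is_subgroup) fact
  have "marked_group k ?H S"
    unfolding marked_group_def
    using assms generate.incl[of _ "set S" G] subgroup_imp_group[OF sub] generate_consistent[OF _ sub, of "set S"]
    by auto
  from word_eval_hom[OF this] have hom: "word_eval ?H S \<in> hom (free_group k) ?H" .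
  have eq: "word_eval ?H S w = word_eval G S w" if "w \<in> carrier (free_group k)" for w
    by (rule word_eval_generate) (use assms that in \<open>auto simp: free_group_def\<close>)
  interpret F: group "free_group k" by (rule free_group_group)
  have "word_eval G S \<in> hom (free_group k) G"
  proof (rule homI)
    fix u v assume uv: "u \<in> carrier (free_group k)" "v \<in> carrier (free_group k)"
    show "word_eval G S u \<in> carrier G"
      using hom_in_carrier[OF hom uv(1)] eq[OF uv(1)] generate_incl[OF assms(3)] by auto
    show "word_eval G S (u \<otimes>\<^bsub>free_group k\<^esub> v) = word_eval G S u \<otimes> word_eval G S v"
      using hom_mult[OF hom uv] eq uv by simp
  qed
  then show ?thesis
    by (simp add: group_hom_def group_hom_axioms_def is_group F.is_group)
qed

lemma free_gen_in_free_group: "i < k \<Longrightarrow> free_gen i \<in> carrier (free_group k)"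
  by (simp add: free_group_def reduced_word_def)

lemma word_eval_quotient:
  assumes N: "N \<lhd> free_group k" and "w \<in> carrier (free_group k)"
  shows "word_eval (free_group k Mod N) (map (\<lambda>i. N #>\<^bsub>free_group k\<^esub> free_gen i) [0..<k]) w =
         N #>\<^bsub>free_group k\<^esub> w"
    (is "word_eval ?Q ?S w = _")
proof -
  interpret N: normal N "free_group k" by fact
  interpret Q: group ?Q by (rule N.factorgroup_is_group)
  have mk: "marked_group k ?Q ?S" by (rule marked_group_quotient[OF N])
  have mult: "(N #>\<^bsub>free_group k\<^esub> u) \<otimes>\<^bsub>?Q\<^esub> (N #>\<^bsub>free_group k\<^esub> v) =
    N #>\<^bsub>free_group k\<^esub> (u \<otimes>\<^bsub>free_group k\<^esub> v)"
    if "u \<in> carrier (free_group k)" "v \<in> carrier (free_group k)" for u v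
    using N.rcos_sum[OF that] by (simp add: FactGroup_def)
  have one: "N #>\<^bsub>free_group k\<^esub> \<one>\<^bsub>free_group k\<^esub> = \<one>\<^bsub>?Q\<^esub>"
    using N.subset by (simp add: N.coset_mult_one FactGroup_def)
  have letter: "letter_eval ?Q ?S x = N #>\<^bsub>free_group k\<^esub> [x]" if "fst x < k" for x
  proof (cases "snd x")
    case True
    then show ?thesis using that by (cases x) (simp add: letter_eval_def)
  next
    case False
    have x: "[x] \<in> carrier (free_group k)" using that by (simp add: free_group_def reduced_word_def)
    have "[x] \<otimes>\<^bsub>free_group k\<^esub> free_gen (fst x) = \<one>\<^bsub>free_group k\<^esub>"
      using False by (cases x) (simp add: free_group_def inv_letter_def)
    then have "(N #>\<^bsub>free_group k\<^esub> [x]) \<otimes>\<^bsub>?Q\<^esub> (N #>\<^bsub>free_group k\<^esub> free_gen (fst x)) = \<one>\<^bsub>?Q\<^esub>"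
      using mult[OF x free_gen_in_free_group[OF that]] one by simp
    moreover have "N #>\<^bsub>free_group k\<^esub> u \<in> carrier ?Q" if "u \<in> carrier (free_group k)" for u
      using N.rcosetsI[OF N.subset that] by (simp add: FactGroup_def)
    ultimately show ?thesis
      using that False x free_gen_in_free_group[OF that] Q.inv_equality
      by (simp add: letter_eval_def)
  qed
  show ?thesis using assms(2)
  proof (induction w)
    case Nil
    then show ?case using one by (simp add: free_group_def)
  next
    case (Cons x w)
    then have x: "fst x < k" "[x] \<in> carrier (free_group k)" and w: "w \<in> carrier (free_group k)"
      by (auto simp: free_group_def reduced_Cons)
    have "[x] \<otimes>\<^bsub>free_group k\<^esub> w = x # w"
      using Cons.prems by (simp add: free_group_def red_cons_reduced)
    then show ?case using Cons.IH[OF w] letter[OF x(1)] mult[OF x(2) w] by simp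
  qed
qed

text \<open>Converts the word problem of the marked group \<open>F\<^sub>k / N\<close> into membership in \<open>N\<close>; it serves both
  for presented groups and for the limits constructed in the compactness argument.\<close>

lemma trivial_word_quotient_iff:
  assumes N: "N \<lhd> free_group k" and w: "w \<in> carrier (free_group k)"
  shows "trivial_word (marked_iso_rel k ``
           {(free_group k Mod N, map (\<lambda>i. N #>\<^bsub>free_group k\<^esub> free_gen i) [0..<k])}) w \<longleftrightarrow> w \<in> N"
proof -
  interpret N: normal N "free_group k" by fact
  have "N #>\<^bsub>free_group k\<^esub> w = N \<longleftrightarrow> w \<in> N"
    using N.coset_join1[OF _ w N.subgroup_axioms] N.coset_join2[OF w N.subgroup_axioms] by blast
  then show ?thesis
    using trivial_word_class[OF marked_group_quotient[OF N] w] word_eval_quotient[OF N w]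
    by (simp add: FactGroup_def)
qed

section \<open>Conjugation in groups with a Baumslag--Solitar relation\<close>

text \<open>The homomorphisms from \<open>BS(m, n)\<close> to \<open>G\<close> correspond to the pairs \<open>(a, b)\<close> of this kind. The
  computations below are needed twice, in \<open>BS(m, n)\<close> itself and in a permutation representation.\<close>

definition BS_pair :: "('a, 'b) monoid_scheme \<Rightarrow> int \<Rightarrow> int \<Rightarrow> 'a \<Rightarrow> 'a \<Rightarrow> bool" where
  "BS_pair G m n a b \<longleftrightarrow> group G \<and> a \<in> carrier G \<and> b \<in> carrier G \<and>
     a \<otimes>\<^bsub>G\<^esub> (b [^]\<^bsub>G\<^esub> m) \<otimes>\<^bsub>G\<^esub> inv\<^bsub>G\<^esub> a = b [^]\<^bsub>G\<^esub> n"

definition conj_by :: "('a, 'b) monoid_scheme \<Rightarrow> 'a \<Rightarrow> 'a \<Rightarrow> 'a" where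
  "conj_by G g x = g \<otimes>\<^bsub>G\<^esub> x \<otimes>\<^bsub>G\<^esub> inv\<^bsub>G\<^esub> g"

lemma group_hom_conj_by:
  fixes G (structure)
  assumes "group G" "g \<in> carrier G"
  shows "group_hom G G (conj_by G g)"
proof -
  interpret group G by fact
  have "conj_by G g \<in> hom G G"
  proof (rule homI)
    fix x y assume "x \<in> carrier G" "y \<in> carrier G"
    then show "conj_by G g (x \<otimes> y) = conj_by G g x \<otimes> conj_by G g y"
      using assms(2) by (simp add: conj_by_def m_assoc inv_solve_left)
  qed (use assms(2) in \<open>simp add: conj_by_def\<close>)
  then show ?thesis by (simp add: group_hom_def group_hom_axioms_def is_group)
qed

lemma conj_by_mult:
  fixes G (structure)
  assumes "group G" "g \<in> carrier G" "h \<in> carrier G" "x \<in> carrier G"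
  shows "conj_by G (g \<otimes>\<^bsub>G\<^esub> h) x = conj_by G g (conj_by G h x)"
proof -
  interpret group G by fact
  show ?thesis using assms by (simp add: conj_by_def m_assoc inv_mult_group)
qed

lemma conj_by_inject:
  fixes G (structure)
  assumes "group G" "g \<in> carrier G" "x \<in> carrier G" "y \<in> carrier G"
  shows "conj_by G g x = conj_by G g y \<longleftrightarrow> x = y"
proof -
  interpret group G by fact
  show ?thesis using assms by (simp add: conj_by_def)
qed

lemma BS_pair_iff_conj_by:
  "BS_pair G m n a b \<longleftrightarrow> group G \<and> a \<in> carrier G \<and> b \<in> carrier G \<and>
     conj_by G a (b [^]\<^bsub>G\<^esub> m) = b [^]\<^bsub>G\<^esub> n"
  by (simp add: BS_pair_def conj_by_def)

lemma BS_pair_conj_pow: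
  fixes G (structure)
  assumes "BS_pair G m n a b"
  shows "conj_by G a (b [^]\<^bsub>G\<^esub> (m * q)) = b [^]\<^bsub>G\<^esub> (n * q)"
proof -
  interpret group G using assms by (simp add: BS_pair_def)
  interpret c: group_hom G G "conj_by G a"
    by (rule group_hom_conj_by) (use assms in \<open>auto simp: BS_pair_def\<close>)
  have b: "b \<in> carrier G" and r: "conj_by G a (b [^] m) = b [^] n"
    using assms by (auto simp: BS_pair_iff_conj_by)
  have "conj_by G a (b [^] (m * q)) = conj_by G a ((b [^] m) [^] q)"
    using b by (simp add: int_pow_pow)
  also have "\<dots> = (conj_by G a (b [^] m)) [^] q" using b by (simp add: c.hom_int_pow)
  finally show ?thesis using b r by (simp add: int_pow_pow)
qed

lemma conj_by_nat_pow_Suc: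
  fixes G (structure)
  assumes "group G" "g \<in> carrier G" "x \<in> carrier G"
  shows "conj_by G (g [^]\<^bsub>G\<^esub> Suc h) x = conj_by G (g [^]\<^bsub>G\<^esub> h) (conj_by G g x)"
proof -
  interpret group G by fact
  show ?thesis using assms by (simp add: conj_by_mult)
qed

lemma BS_pair_conj_nat_pow:
  fixes G (structure)
  assumes "BS_pair G m n a b"
  shows "conj_by G (a [^]\<^bsub>G\<^esub> (h::nat)) (b [^]\<^bsub>G\<^esub> (m ^ h * q)) = b [^]\<^bsub>G\<^esub> (n ^ h * q)"
proof (induction h arbitrary: q)
  case 0
  interpret group G using assms by (simp add: BS_pair_def)
  show ?case using assms by (simp add: BS_pair_def conj_by_def)
next
  case (Suc h)
  interpret group G using assms by (simp add: BS_pair_def)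
  have ab: "a \<in> carrier G" "b \<in> carrier G" using assms by (auto simp: BS_pair_def)
  have "conj_by G (a [^] Suc h) (b [^] (m ^ Suc h * q)) =
        conj_by G (a [^] h) (conj_by G a (b [^] (m * (m ^ h * q))))"
    using ab by (simp only: conj_by_nat_pow_Suc is_group int_pow_closed power_Suc mult.assoc)
  also have "\<dots> = conj_by G (a [^] h) (b [^] (m ^ h * (n * q)))"
    using BS_pair_conj_pow[OF assms, of "m ^ h * q"] by (simp add: mult.left_commute)
  also have "\<dots> = b [^] (n ^ Suc h * q)" using Suc.IH[of "n * q"] by (simp add: ac_simps)
  finally show ?case .
qed

definition commute_in :: "('a, 'b) monoid_scheme \<Rightarrow> 'a \<Rightarrow> 'a \<Rightarrow> bool" where
  "commute_in G x y \<longleftrightarrow> x \<otimes>\<^bsub>G\<^esub> y = y \<otimes>\<^bsub>G\<^esub> x"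

lemma commute_in_int_pow:
  fixes G (structure)
  assumes "group G" "x \<in> carrier G" "y \<in> carrier G" "commute_in G x y"
  shows "commute_in G x (y [^]\<^bsub>G\<^esub> (k::int))"
proof -
  interpret group G by fact
  interpret c: group_hom G G "conj_by G x" by (rule group_hom_conj_by) fact+
  have eq: "commute_in G x z \<longleftrightarrow> conj_by G x z = z" if "z \<in> carrier G" for z
    using that assms(2) by (metis commute_in_def conj_by_def inv_solve_right' m_closed)
  show ?thesis using assms by (simp add: eq c.hom_int_pow)
qed

text \<open>The only obstruction to pushing a power of \<open>b\<close> through \<open>h\<close> conjugations by \<open>a\<close> is divisibility by
  \<open>m\<close> at each stage. If \<open>m\<close> divides \<open>k\<close>, one conjugation turns \<open>b\<^sup>k\<close> into a power of \<open>b\<close> whose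
  exponent is \<open>n k / m\<close>: one factor \<open>m\<close> is lost, and \<open>n\<close>, being prime to \<open>m\<close>, contributes none. If
  \<open>m\<close> does not divide \<open>k\<close>, undoing all conjugations but one shows that \<open>a b\<^sup>k a\<^sup>-\<^sup>1\<close> commutes with a
  power of \<open>b\<close> whose exponent is a power of \<open>m\<close>, hence not divisible by \<open>n\<close>, which is prime to \<open>m\<close> and
  not a unit. The hypothesis \<open>reduced\<close> excludes this; it is the case of Britton's lemma for the words
  \<open>[a b\<^sup>K a\<^sup>-\<^sup>1, b\<^sup>M]\<close>.\<close>

lemma BS_pair_commute_dvd:
  fixes G (structure)
  assumes bs: "BS_pair G m n a b" and "coprime m n"
    and reduced: "\<And>K M. commute_in G (conj_by G a (b [^]\<^bsub>G\<^esub> K)) (b [^]\<^bsub>G\<^esub> M) \<Longrightarrow> m dvd K \<or> n dvd M"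
    and "\<bar>n\<bar> \<noteq> 1"
    and "commute_in G (conj_by G (a [^]\<^bsub>G\<^esub> (h::nat)) (b [^]\<^bsub>G\<^esub> k)) b"
  shows "m ^ h dvd k"
  using assms(5)
proof (induction h arbitrary: k)
  case (Suc h)
  interpret group G using bs by (simp add: BS_pair_def)
  have ab [simp]: "a \<in> carrier G" "b \<in> carrier G" using bs by (auto simp: BS_pair_def)
  interpret c: group_hom G G "conj_by G (a [^] h)" by (rule group_hom_conj_by) (simp_all add: is_group)
  have closed: "conj_by G a (b [^] k) \<in> carrier G" for k :: int by (simp add: conj_by_def)
  have conj_Suc: "conj_by G (a [^] Suc h) (b [^] k) = conj_by G (a [^] h) (conj_by G a (b [^] k))"
    by (simp only: conj_by_nat_pow_Suc is_group int_pow_closed ab)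
  have "m dvd k"
  proof -
    have "commute_in G (conj_by G (a [^] h) (conj_by G a (b [^] k))) (b [^] (n ^ h))"
      using Suc.prems closed unfolding conj_Suc
      by (intro commute_in_int_pow c.hom_closed) (simp_all add: is_group)
    then have "commute_in G (conj_by G (a [^] h) (conj_by G a (b [^] k)))
                 (conj_by G (a [^] h) (b [^] (m ^ h)))"
      using BS_pair_conj_nat_pow[OF bs, of h 1] by simp
    then have "conj_by G (a [^] h) (conj_by G a (b [^] k) \<otimes> b [^] (m ^ h)) =
               conj_by G (a [^] h) (b [^] (m ^ h) \<otimes> conj_by G a (b [^] k))"
      using closed by (simp add: commute_in_def)
    then have "commute_in G (conj_by G a (b [^] k)) (b [^] (m ^ h))"
      unfolding commute_in_def
      by (subst (asm) conj_by_inject) (use closed in \<open>simp_all add: is_group\<close>)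
    then have "m dvd k \<or> n dvd m ^ h" by (rule reduced)
    moreover have "\<not> n dvd m ^ h"
    proof
      assume "n dvd m ^ h"
      moreover have "coprime (m ^ h) n" using \<open>coprime m n\<close> by simp
      ultimately have "is_unit n" by (meson coprime_common_divisor dvd_refl)
      with \<open>\<bar>n\<bar> \<noteq> 1\<close> show False by simp
    qed
    ultimately show ?thesis by blast
  qed
  then obtain k' where k: "k = m * k'" ..
  have "commute_in G (conj_by G (a [^] h) (b [^] (n * k'))) b"
    using Suc.prems unfolding conj_Suc unfolding k BS_pair_conj_pow[OF bs] .
  then have "m ^ h dvd n * k'" by (rule Suc.IH)
  moreover have "coprime (m ^ h) n" using \<open>coprime m n\<close> by simp
  ultimately have "m ^ h dvd k'" by (simp add: coprime_dvd_mult_right_iff)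
  then show ?case by (simp add: k)
qed simp

section \<open>A permutation representation\<close>

text \<open>To verify Britton's lemma for \<open>[a b\<^sup>K a\<^sup>-\<^sup>1, b\<^sup>M]\<close>, it is enough to exhibit permutations that satisfy the
  relation and for which this commutator moves a point. Let \<open>b\<close> translate the first coordinate of
  \<open>\<int> \<times> \<int>\<close> by one. Both \<open>b\<^sup>m\<close> and \<open>b\<^sup>n\<close> act freely with infinitely many orbits, hence any bijection
  between their orbits, together with base points, yields a permutation \<open>a\<close> with
  \<open>a b\<^sup>m a\<^sup>-\<^sup>1 = b\<^sup>n\<close>. Call the second coordinate the level. The bijection is chosen such that,
  apart from the orbit of the origin, which goes to the orbit of the origin, the orbits of \<open>b\<^sup>m\<close> at
  level \<open>0\<close> go to positive levels, and the orbits of \<open>b\<^sup>n\<close> at level \<open>0\<close> come from negative levels.\<close>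

definition perm_group :: "('a \<Rightarrow> 'a) monoid" where
  "perm_group = \<lparr>carrier = {f. bij f}, mult = (\<circ>), one = id\<rparr>"

lemma perm_group_simps [simp]:
  "f \<in> carrier perm_group \<longleftrightarrow> bij f" "f \<otimes>\<^bsub>perm_group\<^esub> g = f \<circ> g" "\<one>\<^bsub>perm_group\<^esub> = id"
  by (simp_all add: perm_group_def)

lemma group_perm_group: "group perm_group"
proof (rule groupI)
  fix f :: "'a \<Rightarrow> 'a" assume "f \<in> carrier perm_group"
  then show "\<exists>g\<in>carrier perm_group. g \<otimes>\<^bsub>perm_group\<^esub> f = \<one>\<^bsub>perm_group\<^esub>"
    by (intro bexI[of _ "inv_into UNIV f"]) (auto simp: bij_imp_bij_inv bij_is_inj)
qed (auto simp: bij_comp comp_assoc)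

definition slide :: "int \<Rightarrow> int \<times> int \<Rightarrow> int \<times> int" where
  "slide k p = (fst p + k, snd p)"

text \<open>Coordinates adapted to the powers of the translation by \<open>m\<close>: the first coordinate of \<open>coil m p\<close>
  numbers the orbit of \<open>p\<close> (orbits of level \<open>i\<close> have the numbers from \<open>\<bar>m\<bar> i\<close> to \<open>\<bar>m\<bar> i + \<bar>m\<bar> - 1\<close>), the
  second is the position in the orbit.\<close>

definition coil :: "int \<Rightarrow> int \<times> int \<Rightarrow> int \<times> int" where
  "coil m p = (\<bar>m\<bar> * snd p + \<bar>fst p mod m\<bar>, fst p div m)"

definition uncoil :: "int \<Rightarrow> int \<times> int \<Rightarrow> int \<times> int" where
  "uncoil m q = (m * snd q + sgn m * (fst q mod \<bar>m\<bar>), fst q div \<bar>m\<bar>)"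

text \<open>A bijection of \<open>\<int>\<close> that fixes \<open>0\<close>, maps the positive numbers onto those that are at least \<open>\<bar>n\<bar>\<close>, and
  the negative numbers onto the nonzero ones below \<open>\<bar>n\<bar>\<close>.\<close>

definition shift :: "int \<Rightarrow> int \<Rightarrow> int" where
  "shift n c = (if c = 0 then 0 else if c > 0 \<or> c \<le> - \<bar>n\<bar> then c + \<bar>n\<bar> - 1 else c + \<bar>n\<bar>)"

definition unshift :: "int \<Rightarrow> int \<Rightarrow> int" where
  "unshift n c = (if c = 0 then 0 else if c < 0 \<or> c \<ge> \<bar>n\<bar> then c - \<bar>n\<bar> + 1 else c - \<bar>n\<bar>)"

definition stable_perm :: "int \<Rightarrow> int \<Rightarrow> int \<times> int \<Rightarrow> int \<times> int" where
  "stable_perm m n = uncoil n \<circ> map_prod (shift n) id \<circ> coil m"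

lemma bij_slide: "bij (slide k)"
  by (rule o_bij[of "slide (- k)"]) (auto simp: slide_def)

lemma slide_int_pow: "slide 1 [^]\<^bsub>perm_group\<^esub> (k::int) = slide k"
proof -
  interpret group "perm_group :: (int \<times> int \<Rightarrow> int \<times> int) monoid" by (rule group_perm_group)
  have nat: "slide 1 [^]\<^bsub>perm_group\<^esub> (j::nat) = slide (int j)" for j
    by (induction j) (auto simp: slide_def fun_eq_iff nat_pow_Suc)
  have inv: "inv\<^bsub>perm_group\<^esub> (slide j) = slide (- j)" for j
    by (rule inv_equality) (auto simp: bij_slide slide_def)
  show ?thesis by (auto simp: int_pow_def2 nat inv)
qed

lemma sgn_mult_abs_mod: "m \<noteq> 0 \<Longrightarrow> sgn m * \<bar>x mod m\<bar> = x mod (m::int)"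
  by (cases "m > 0") (auto simp: abs_of_nonneg abs_of_nonpos)

lemma uncoil_coil: "m \<noteq> 0 \<Longrightarrow> uncoil m (coil m p) = p"
proof -
  assume m: "m \<noteq> 0"
  have lt: "\<bar>fst p mod m\<bar> < \<bar>m\<bar>" using m by (rule abs_mod_less)
  then have "(\<bar>m\<bar> * snd p + \<bar>fst p mod m\<bar>) mod \<bar>m\<bar> = \<bar>fst p mod m\<bar>"
    "(\<bar>m\<bar> * snd p + \<bar>fst p mod m\<bar>) div \<bar>m\<bar> = snd p"
    using m by simp_all
  then show ?thesis
    using sgn_mult_abs_mod[OF m, of "fst p"] by (simp add: uncoil_def coil_def)
qed

lemma coil_uncoil: "m \<noteq> 0 \<Longrightarrow> coil m (uncoil m q) = q"
proof -
  assume m: "m \<noteq> 0"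
  define r where "r = fst q mod \<bar>m\<bar>"
  have r: "0 \<le> r" "r < \<bar>m\<bar>" using m by (simp_all add: r_def)
  have "sgn m * r mod m = sgn m * r" "sgn m * r div m = 0"
    using r m by (cases "m > 0"; simp add: mod_neg_neg_trivial div_neg_neg_trivial)+
  then have mod: "(m * snd q + sgn m * r) mod m = sgn m * r"
    and div: "(m * snd q + sgn m * r) div m = snd q"
    using m by simp_all
  have abs: "\<bar>sgn m * r\<bar> = r" using r m by (simp add: abs_mult)
  have q: "\<bar>m\<bar> * (fst q div \<bar>m\<bar>) + r = fst q" by (simp add: r_def)
  show ?thesis unfolding coil_def uncoil_def r_def[symmetric] fst_conv snd_conv mod div abs q
    by simp
qed

lemma bij_stable_perm:
  assumes "m \<noteq> 0" "n \<noteq> 0"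
  shows "bij (stable_perm m n)"
proof (rule o_bij)
  have "shift n (unshift n c) = c" "unshift n (shift n c) = c" for c
    using assms(2) by (auto simp: shift_def unshift_def)
  then show "(uncoil m \<circ> map_prod (unshift n) id \<circ> coil n) \<circ> stable_perm m n = id"
    "stable_perm m n \<circ> (uncoil m \<circ> map_prod (unshift n) id \<circ> coil n) = id"
    using assms by (simp_all add: stable_perm_def fun_eq_iff coil_uncoil uncoil_coil map_prod_def split_beta)
qed

lemma BS_pair_stable_perm:
  assumes "m \<noteq> 0" "n \<noteq> 0"
  shows "BS_pair perm_group m n (stable_perm m n) (slide 1)"
proof -
  interpret group "perm_group :: (int \<times> int \<Rightarrow> int \<times> int) monoid" by (rule group_perm_group)
  have "stable_perm m n \<circ> slide m = slide n \<circ> stable_perm m n"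
    using assms by (auto simp: stable_perm_def coil_def uncoil_def slide_def fun_eq_iff distrib_left)
  then have "slide n = stable_perm m n \<circ> slide m \<circ> inv\<^bsub>perm_group\<^esub> (stable_perm m n)"
    using inv_solve_right[of "slide n" "stable_perm m n \<circ> slide m" "stable_perm m n"]
      bij_stable_perm[OF assms] by (simp add: bij_slide bij_comp)
  then show ?thesis
    by (simp add: BS_pair_def group_perm_group bij_stable_perm assms slide_int_pow bij_slide)
qed

text \<open>Apply \<open>b\<^sup>M\<close> and \<open>a b\<^sup>K a\<^sup>-\<^sup>1\<close>, in both orders, to the origin, which \<open>a\<close> fixes. If \<open>m\<close> does not
  divide \<open>K\<close>, then \<open>a b\<^sup>K a\<^sup>-\<^sup>1\<close> moves it to a positive level, and the level is not changed by \<open>b\<^sup>M\<close>. If \<open>n\<close> does not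
  divide \<open>M\<close>, then \<open>a\<^sup>-\<^sup>1\<close> moves \<open>(M, 0)\<close> to a negative level, from which \<open>a b\<^sup>K\<close> cannot reach a
  positive one.\<close>

lemma stable_perm_reduced:
  assumes "m \<noteq> 0" "n \<noteq> 0"
    and "commute_in perm_group (conj_by perm_group (stable_perm m n) (slide K)) (slide M)"
  shows "m dvd K \<or> n dvd M"
proof (rule ccontr)
  assume not: "\<not> (m dvd K \<or> n dvd M)"
  interpret group "perm_group :: (int \<times> int \<Rightarrow> int \<times> int) monoid" by (rule group_perm_group)
  let ?a = "stable_perm m n"
  let ?a' = "inv\<^bsub>perm_group\<^esub> ?a"
  have a: "bij ?a" by (rule bij_stable_perm) fact+
  have aa': "?a (?a' p) = p" and a'a: "?a' (?a p) = p" for p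
    using fun_cong[OF r_inv[of ?a, simplified, OF a]] fun_cong[OF l_inv[of ?a, simplified, OF a]] by simp_all
  have snd_a: "snd (?a p) = shift n (\<bar>m\<bar> * snd p + \<bar>fst p mod m\<bar>) div \<bar>n\<bar>" for p
    by (simp add: stable_perm_def uncoil_def coil_def)
  have comm: "?a (slide K (?a' (slide M p))) = slide M (?a (slide K (?a' p)))" for p
    using fun_cong[OF assms(3)[unfolded commute_in_def], of p] by (simp add: conj_by_def)
  have "?a (0, 0) = (0, 0)" by (simp add: stable_perm_def uncoil_def coil_def shift_def)
  then have "?a' (0, 0) = (0, 0)" using a'a[of "(0, 0)"] by simp
  then have R: "snd (?a (slide K (?a' (slide M (0, 0))))) = snd (?a (K, 0))"
    unfolding comm by (simp add: slide_def)
  have "\<bar>K mod m\<bar> > 0" using not by (auto simp: dvd_eq_mod_eq_0)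
  then have "shift n \<bar>K mod m\<bar> \<ge> \<bar>n\<bar>" by (simp add: shift_def)
  then have "snd (?a (K, 0)) \<ge> 1"
    using assms(2) unfolding snd_a by (simp add: pos_imp_zdiv_pos_iff int_one_le_iff_zero_less)
  moreover define z where "z = ?a' (M, 0)"
  have "coil n (?a z) = map_prod (shift n) id (coil m z)"
    using assms(2) by (simp add: stable_perm_def coil_uncoil)
  then have c: "shift n (\<bar>m\<bar> * snd z + \<bar>fst z mod m\<bar>) = \<bar>M mod n\<bar>"
    by (simp add: z_def aa' coil_def)
  have "0 < \<bar>M mod n\<bar>" "\<bar>M mod n\<bar> < \<bar>n\<bar>"
    using not assms(2) by (auto simp: dvd_eq_mod_eq_0 abs_mod_less)
  then have "\<bar>m\<bar> * snd z + \<bar>fst z mod m\<bar> < 0"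
    unfolding c[symmetric] shift_def by (auto split: if_splits)
  then have "snd z < 0" using assms(1) by (smt (verit) mult_nonneg_nonneg)
  have "\<bar>m\<bar> * snd z + \<bar>(fst z + K) mod m\<bar> < 0"
  proof -
    have "\<bar>(fst z + K) mod m\<bar> < \<bar>m\<bar>" using assms(1) by (rule abs_mod_less)
    moreover have "\<bar>m\<bar> * snd z \<le> \<bar>m\<bar> * (-1)" using \<open>snd z < 0\<close> by (intro mult_left_mono) auto
    ultimately show ?thesis by simp
  qed
  then have "shift n (\<bar>m\<bar> * snd z + \<bar>(fst z + K) mod m\<bar>) < \<bar>n\<bar>"
    using assms(2) unfolding shift_def by auto
  then have "snd (?a (slide K z)) \<le> 0"
    using assms(2) unfolding snd_a slide_def fst_conv snd_conv by (smt (verit) pos_imp_zdiv_pos_iff zero_less_abs_iff)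
  ultimately show False using R by (simp add: z_def slide_def)
qed

section \<open>Words of Baumslag--Solitar groups that measure congruences\<close>

lemma BS_relator_in_free_group: "BS_relator m n \<in> carrier (free_group 2)"
proof -
  interpret F: group "free_group 2" by (rule free_group_group)
  show ?thesis by (simp add: BS_relator_def Let_def free_gen_in_free_group)
qed

lemma trivial_word_BS_iff:
  assumes "w \<in> carrier (free_group 2)"
  shows "trivial_word (BS m n) w \<longleftrightarrow> w \<in> normal_closure (free_group 2) {BS_relator m n}"
proof -
  interpret F: group "free_group 2" by (rule free_group_group)
  have "{BS_relator m n} \<subseteq> carrier (free_group 2)"
    using BS_relator_in_free_group by simp
  from normal_closure_normal[OF F.is_group this] show ?thesis
    unfolding BS_def presented_group_def presented_marking_def
    by (rule trivial_word_quotient_iff) fact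
qed

lemma word_eval_BS_relator:
  fixes G (structure)
  assumes "group G" "a \<in> carrier G" "b \<in> carrier G"
  shows "word_eval G [a, b] (BS_relator m n) = \<one> \<longleftrightarrow> conj_by G a (b [^] m) = b [^] n"
proof -
  interpret G: group G by fact
  interpret h: group_hom "free_group 2" G "word_eval G [a, b]"
    by (rule group_hom_word_eval) (use assms in auto)
  have gens: "free_gen 0 \<in> carrier (free_group 2)" "free_gen 1 \<in> carrier (free_group 2)"
    by (simp_all add: free_gen_in_free_group)
  have "word_eval G [a, b] (free_gen 0) = a" "word_eval G [a, b] (free_gen 1) = b"
    using assms by (simp_all add: letter_eval_def)
  then have "word_eval G [a, b] (BS_relator m n) = conj_by G a (b [^] m) \<otimes> inv (b [^] n)"
    using gens by (simp add: BS_relator_def Let_def conj_by_def h.hom_int_pow del: word_eval_simps)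
  moreover have "conj_by G a (b [^] m) \<in> carrier G" using assms by (simp add: conj_by_def)
  ultimately show ?thesis using assms G.inv_solve_right'[of \<one>] by auto
qed

lemma trivial_word_BS_imp:
  assumes bs: "BS_pair G m n a b" and w: "w \<in> carrier (free_group 2)" "trivial_word (BS m n) w"
  shows "word_eval G [a, b] w = \<one>\<^bsub>G\<^esub>"
proof -
  interpret h: group_hom "free_group 2" G "word_eval G [a, b]"
    by (rule group_hom_word_eval) (use bs in \<open>auto simp: BS_pair_def\<close>)
  have "{BS_relator m n} \<subseteq> kernel (free_group 2) G (word_eval G [a, b])"
    using bs by (simp add: kernel_def BS_relator_in_free_group word_eval_BS_relator BS_pair_iff_conj_by)
  then have "normal_closure (free_group 2) {BS_relator m n} \<subseteq> kernel (free_group 2) G (word_eval G [a, b])"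
    unfolding normal_closure_def using h.normal_kernel by blast
  then show ?thesis using w by (auto simp: trivial_word_BS_iff kernel_def)
qed

text \<open>The presented group is itself a model of its relation, and the generic one. Together with
  \<open>trivial_word_BS_imp\<close> this reduces the word problem to computations with pairs.\<close>

lemma BS_universal_pair:
  obtains G :: "letter list set monoid" and a b where "BS_pair G m n a b"
    "\<forall>w\<in>carrier (free_group 2). trivial_word (BS m n) w \<longleftrightarrow> word_eval G [a, b] w = \<one>\<^bsub>G\<^esub>"
proof -
  interpret F: group "free_group 2" by (rule free_group_group)
  let ?N = "normal_closure (free_group 2) {BS_relator m n}"
  define G where "G = presented_group 2 {BS_relator m n}"
  define a where "a = ?N #>\<^bsub>free_group 2\<^esub> free_gen 0"
  define b where "b = ?N #>\<^bsub>free_group 2\<^esub> free_gen 1"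
  have N: "?N \<lhd> free_group 2"
    using BS_relator_in_free_group by (intro normal_closure_normal F.is_group) simp
  have S: "presented_marking 2 {BS_relator m n} = [a, b]"
    by (simp add: presented_marking_def a_def b_def upt_rec)
  have mk: "marked_group 2 G [a, b]"
    using marked_group_quotient[OF N] S by (simp add: G_def presented_group_def presented_marking_def)
  have tw: "\<forall>w\<in>carrier (free_group 2). trivial_word (BS m n) w \<longleftrightarrow> word_eval G [a, b] w = \<one>\<^bsub>G\<^esub>"
    using trivial_word_class[OF mk] by (simp add: BS_def S flip: G_def)
  have "trivial_word (BS m n) (BS_relator m n)"
    unfolding trivial_word_BS_iff[OF BS_relator_in_free_group] normal_closure_def by blast
  then have "BS_pair G m n a b"
    using mk tw BS_relator_in_free_group
    by (auto simp: BS_pair_iff_conj_by marked_group_def word_eval_BS_relator)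
  from this tw show thesis by (rule that)
qed

text \<open>The commutator of \<open>a\<^sup>h (a b\<^sup>m a\<^sup>-\<^sup>1 b\<^sup>-\<^sup>r) a\<^sup>-\<^sup>h\<close> with \<open>b\<close>. The integer \<open>n\<close> does not enter, so
  that one word can be tested in all groups \<open>BS(m, n)\<close>; there the inner bracket becomes
  the power of \<open>b\<close> with exponent \<open>n - r\<close>.\<close>

definition congruence_word :: "int \<Rightarrow> nat \<Rightarrow> int \<Rightarrow> letter list" where
  "congruence_word m h r =
     (let F = free_group 2; a = free_gen 0; b = free_gen 1;
          c = conj_by F (a [^]\<^bsub>F\<^esub> h) (conj_by F a (b [^]\<^bsub>F\<^esub> m) \<otimes>\<^bsub>F\<^esub> inv\<^bsub>F\<^esub> (b [^]\<^bsub>F\<^esub> r))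
      in c \<otimes>\<^bsub>F\<^esub> b \<otimes>\<^bsub>F\<^esub> inv\<^bsub>F\<^esub> c \<otimes>\<^bsub>F\<^esub> inv\<^bsub>F\<^esub> b)"

lemma congruence_word_in_free_group: "congruence_word m h r \<in> carrier (free_group 2)"
proof -
  interpret F: group "free_group 2" by (rule free_group_group)
  show ?thesis by (simp add: congruence_word_def Let_def conj_by_def free_gen_in_free_group)
qed

lemma word_eval_congruence_word:
  fixes G (structure)
  assumes bs: "BS_pair G m n a b"
  shows "word_eval G [a, b] (congruence_word m h r) = \<one> \<longleftrightarrow>
         commute_in G (conj_by G (a [^] h) (b [^] (n - r))) b"
proof -
  interpret G: group G using bs by (simp add: BS_pair_def)
  have ab [simp]: "a \<in> carrier G" "b \<in> carrier G" using bs by (auto simp: BS_pair_def)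
  interpret h: group_hom "free_group 2" G "word_eval G [a, b]"
    by (rule group_hom_word_eval) (simp_all add: G.is_group)
  define c where "c = conj_by G (a [^] h) (b [^] (n - r))"
  have c [simp]: "c \<in> carrier G" by (simp add: c_def conj_by_def)
  have gens: "free_gen 0 \<in> carrier (free_group 2)" "free_gen 1 \<in> carrier (free_group 2)"
    by (simp_all add: free_gen_in_free_group)
  have gen_eval: "word_eval G [a, b] (free_gen 0) = a" "word_eval G [a, b] (free_gen 1) = b"
    by (simp_all add: letter_eval_def)
  have conj: "word_eval G [a, b] (conj_by (free_group 2) u v) =
      conj_by G (word_eval G [a, b] u) (word_eval G [a, b] v)"
    and closed: "conj_by (free_group 2) u v \<in> carrier (free_group 2)"
    if "u \<in> carrier (free_group 2)" "v \<in> carrier (free_group 2)" for u v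
    using that by (simp_all add: conj_by_def)
  have "c = conj_by G (a [^] h) (conj_by G a (b [^] m) \<otimes> inv (b [^] r))"
    using bs by (simp add: c_def BS_pair_iff_conj_by G.int_pow_diff)
  then have "word_eval G [a, b] (congruence_word m h r) = c \<otimes> b \<otimes> inv c \<otimes> inv b"
    using gens gen_eval
    by (simp add: congruence_word_def Let_def conj closed h.hom_int_pow h.hom_nat_pow del: word_eval_simps)
  also have "\<dots> = \<one> \<longleftrightarrow> commute_in G c b"
    using G.inv_solve_right'[of \<one> "c \<otimes> b \<otimes> inv c" b] G.inv_solve_right'[of b "c \<otimes> b" c]
    by (auto simp: commute_in_def eq_commute)
  finally show ?thesis by (simp add: c_def)
qed

text \<open>If \<open>n - r\<close> is a multiple of \<open>m ^ h\<close>, then \<open>h\<close> conjugations by \<open>a\<close> turn the power of \<open>b\<close> with this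
  exponent into another power of \<open>b\<close>, and the commutator is trivial. Otherwise it is already
  nontrivial in the permutation representation.\<close>

lemma trivial_congruence_word_iff:
  assumes "coprime n m" "m \<noteq> 0" "\<bar>n\<bar> \<ge> 2"
  shows "trivial_word (BS m n) (congruence_word m h r) \<longleftrightarrow> m ^ h dvd n - r"
proof
  assume "trivial_word (BS m n) (congruence_word m h r)"
  moreover have bs: "BS_pair perm_group m n (stable_perm m n) (slide 1)"
    using assms by (intro BS_pair_stable_perm) auto
  ultimately have "commute_in perm_group
      (conj_by perm_group (stable_perm m n [^]\<^bsub>perm_group\<^esub> h) (slide 1 [^]\<^bsub>perm_group\<^esub> (n - r))) (slide 1)"
    using trivial_word_BS_imp[OF bs congruence_word_in_free_group] word_eval_congruence_word[OF bs] by blast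
  then show "m ^ h dvd n - r"
  proof (rule BS_pair_commute_dvd[OF bs, rotated -1])
    fix K M :: int assume "commute_in perm_group
       (conj_by perm_group (stable_perm m n) (slide 1 [^]\<^bsub>perm_group\<^esub> K)) (slide 1 [^]\<^bsub>perm_group\<^esub> M)"
    then show "m dvd K \<or> n dvd M"
      using assms by (intro stable_perm_reduced) (auto simp: slide_int_pow)
  qed (use assms in \<open>auto simp: coprime_commute\<close>)
next
  assume "m ^ h dvd n - r"
  then obtain q where q: "n - r = m ^ h * q" ..
  obtain G :: "letter list set monoid" and a b where bs: "BS_pair G m n a b" and
    tw: "\<forall>w\<in>carrier (free_group 2). trivial_word (BS m n) w \<longleftrightarrow> word_eval G [a, b] w = \<one>\<^bsub>G\<^esub>"
    by (rule BS_universal_pair[of m n])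
  interpret G: group G using bs by (simp add: BS_pair_def)
  have b: "b \<in> carrier G" using bs by (simp add: BS_pair_def)
  have "commute_in G b (b [^]\<^bsub>G\<^esub> (n ^ h * q))"
    by (rule commute_in_int_pow) (auto simp: b commute_in_def G.is_group)
  then have "commute_in G (conj_by G (a [^]\<^bsub>G\<^esub> h) (b [^]\<^bsub>G\<^esub> (n - r))) b"
    using BS_pair_conj_nat_pow[OF bs] q by (simp add: commute_in_def)
  then show "trivial_word (BS m n) (congruence_word m h r)"
    using tw congruence_word_in_free_group word_eval_congruence_word[OF bs] by blast
qed

text \<open>In the permutation representation \<open>b\<close> has infinite order, so that \<open>a b\<^sup>m a\<^sup>-\<^sup>1\<close> is equal to exactly one
  power of \<open>b\<close>.\<close>

lemma trivial_BS_relator_iff: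
  assumes "m \<noteq> 0" "n \<noteq> 0"
  shows "trivial_word (BS m n) (BS_relator m n') \<longleftrightarrow> n' = n"
proof
  have bs: "BS_pair perm_group m n (stable_perm m n) (slide 1)"
    using assms by (rule BS_pair_stable_perm)
  assume "trivial_word (BS m n) (BS_relator m n')"
  then have "conj_by perm_group (stable_perm m n) (slide 1 [^]\<^bsub>perm_group\<^esub> m) = slide 1 [^]\<^bsub>perm_group\<^esub> n'"
    using trivial_word_BS_imp[OF bs BS_relator_in_free_group] bs
      word_eval_BS_relator[of perm_group "stable_perm m n" "slide 1" m n']
    by (simp add: BS_pair_def)
  then have "slide n = slide n'" using bs by (simp add: BS_pair_iff_conj_by slide_int_pow)
  then have "slide n (0, 0) = slide n' (0, 0)" by simp
  then show "n' = n" by (simp add: slide_def)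
qed (auto simp: trivial_word_BS_iff BS_relator_in_free_group normal_closure_def)

definition same_short_words :: "nat \<Rightarrow> nat \<Rightarrow> marked set \<Rightarrow> marked set \<Rightarrow> bool" where
  "same_short_words k l X Y \<longleftrightarrow>
     (\<forall>w\<in>carrier (free_group k). length w < l \<longrightarrow> trivial_word X w = trivial_word Y w)"

definition admissible :: "int \<Rightarrow> int \<Rightarrow> bool" where
  "admissible m n \<longleftrightarrow> coprime n m \<and> \<bar>n\<bar> \<ge> 2"

text \<open>Uniform continuity of \<open>BS(m, n) \<mapsto> n\<close>: for fixed \<open>h\<close> there are only finitely many residues \<open>r\<close> to test, so that
  the lengths of the words needed are bounded independently of \<open>n\<close>.\<close>

lemma short_words_determine_congruence:
  assumes "\<bar>m\<bar> \<ge> 2"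
  obtains L where "\<And>n n'. admissible m n \<Longrightarrow> admissible m n' \<Longrightarrow>
    same_short_words 2 L (BS m n) (BS m n') \<Longrightarrow> m ^ h dvd n - n'"
proof -
  define ws where "ws = congruence_word m h ` {0..<\<bar>m\<bar> ^ h}"
  define L where "L = Suc (Max (length ` ws))"
  have L: "length w < L" if "w \<in> ws" for w
    using that by (auto simp: L_def ws_def less_Suc_eq_le intro!: Max_ge)
  show thesis
  proof (rule that)
    fix n n' assume n: "admissible m n" "admissible m n'" "same_short_words 2 L (BS m n) (BS m n')"
    define r where "r = n mod \<bar>m\<bar> ^ h"
    have dvd_n: "m ^ h dvd n - r"
    proof -
      have "\<bar>m\<bar> ^ h dvd n - r" by (simp add: r_def minus_mod_eq_mult_div)
      then show ?thesis by (simp flip: power_abs)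
    qed
    have "congruence_word m h r \<in> ws" using assms by (auto simp: ws_def r_def)
    moreover have "trivial_word (BS m n) (congruence_word m h r)"
      using n(1) assms dvd_n by (subst trivial_congruence_word_iff) (auto simp: admissible_def)
    ultimately have "trivial_word (BS m n') (congruence_word m h r)"
      using n(3) L congruence_word_in_free_group by (simp add: same_short_words_def)
    then have "m ^ h dvd n' - r"
      using n(2) assms by (subst (asm) trivial_congruence_word_iff) (auto simp: admissible_def)
    then have "m ^ h dvd (n - r) - (n' - r)" using dvd_n by (rule dvd_diff[rotated])
    then show "m ^ h dvd n - n'" by simp
  qed
qed

section \<open>Compactness of the space of marked groups\<close>

lemma normal_trivial_words:
  assumes "X \<in> marked_groups k"
  shows "{w \<in> carrier (free_group k). trivial_word X w} \<lhd> free_group k"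
proof -
  obtain G S where GS: "marked_group k G S" "X = marked_iso_rel k `` {(G, S)}"
    using assms by (auto simp: marked_groups_def elim!: quotientE)
  interpret h: group_hom "free_group k" G "word_eval G S"
    using GS(1) by (simp add: group_hom_def group_hom_axioms_def word_eval_hom free_group_group marked_group_def)
  have "{w \<in> carrier (free_group k). trivial_word X w} = kernel (free_group k) G (word_eval G S)"
    using GS by (auto simp: kernel_def trivial_word_class)
  then show ?thesis using h.normal_kernel by simp
qed

text \<open>Tychonoff's theorem for \<open>{0, 1}\<close>-valued functions; the product is first countable since the domain
  is countable, so that compactness gives convergent subsequences.\<close>

lemma convergent_subsequence_pointwise:
  fixes f :: "nat \<Rightarrow> 'a::countable \<Rightarrow> bool"
  obtains r g where "strict_mono r" "\<forall>x. \<forall>\<^sub>F i in sequentially. f (r i) x = g x"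
proof -
  \<comment> \<open>Truth values as the real numbers 0 and 1, between which convergence means being eventually constant.\<close>
  let ?F = "\<lambda>i x. if f i x then 1 else (0::real)"
  let ?K = "PiE UNIV (\<lambda>_. {0, 1}) :: ('a \<Rightarrow> real) set"
  have "compactin (product_topology (\<lambda>_. euclidean) UNIV) ?K"
    by (simp add: compactin_PiE finite_imp_compactin)
  then have "compact ?K" by (simp add: euclidean_product_topology)
  then have "seq_compact ?K" by (rule compact_imp_seq_compact)
  moreover have "\<forall>i. ?F i \<in> ?K" by (auto split: if_splits simp: PiE_iff)
  ultimately obtain g r where g: "g \<in> ?K" and r: "strict_mono (r :: nat \<Rightarrow> nat)"
    and lim: "((\<lambda>i. ?F i) \<circ> r) \<longlonglongrightarrow> g"
    by (rule seq_compactE)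
  have "\<forall>x. \<forall>\<^sub>F i in sequentially. f (r i) x = (g x = 1)"
  proof
    fix x
    have "(\<lambda>i. ?F (r i) x) \<longlonglongrightarrow> g x"
      using continuous_on_tendsto_compose[OF continuous_on_product_coordinates lim] by simp
    then have "\<forall>\<^sub>F i in sequentially. dist (?F (r i) x) (g x) < 1" by (rule tendstoD) simp
    moreover have "g x \<in> {0, 1}" using g by blast
    ultimately show "\<forall>\<^sub>F i in sequentially. f (r i) x = (g x = 1)"
      by (auto elim!: eventually_mono split: if_splits)
  qed
  with r show thesis by (rule that)
qed

lemma finite_short_words: "finite {w \<in> carrier (free_group k). length w < l}"
proof (rule finite_subset)
  show "{w \<in> carrier (free_group k). length w < l} \<subseteq>
        {w. set w \<subseteq> {..<k} \<times> UNIV \<and> length w \<le> l}"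
    by (force simp: free_group_def)
qed (rule finite_lists_length_le, simp)

text \<open>A marked group is its set of trivial words. Pass to a subsequence along which the triviality of
  each word is eventually constant; the words that are eventually trivial form a normal subgroup,
  because each closure property involves finitely many words only and holds in every term of the
  sequence. The limit is the quotient by it.\<close>

lemma marked_groups_convergent_subsequence:
  assumes X: "\<And>i :: nat. X i \<in> marked_groups k"
  obtains r Y where "strict_mono r" "Y \<in> marked_groups k"
    "\<forall>w\<in>carrier (free_group k). \<forall>\<^sub>F i in sequentially. trivial_word (X (r i)) w = trivial_word Y w"
proof -
  interpret F: group "free_group k" by (rule free_group_group)
  obtain r g where r: "strict_mono r" and g: "\<forall>w. \<forall>\<^sub>F i in sequentially. trivial_word (X (r i)) w = g w"
    by (rule convergent_subsequence_pointwise[of "\<lambda>i. trivial_word (X i)"])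
  define N where "N = {w \<in> carrier (free_group k). g w}"
  define T where "T i = {w \<in> carrier (free_group k). trivial_word (X (r i)) w}" for i
  have T_normal: "T i \<lhd> free_group k" for i
    unfolding T_def by (rule normal_trivial_words[OF X])
  have T: "subgroup (T i) (free_group k)" for i
    using T_normal by (rule normal_imp_subgroup)
  have agree: "\<exists>i. \<forall>w\<in>set ws. w \<in> N \<longleftrightarrow> w \<in> T i" for ws
  proof -
    have "\<forall>\<^sub>F i in sequentially. \<forall>w\<in>set ws. trivial_word (X (r i)) w = g w"
      using g by (intro eventually_ball_finite) auto
    then obtain i where "\<forall>w\<in>set ws. trivial_word (X (r i)) w = g w"
      unfolding eventually_sequentially by blast
    then show ?thesis by (intro exI[of _ i]) (simp add: N_def T_def)
  qed
  have N: "N \<lhd> free_group k"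
  proof (rule F.normal_invI)
    show "subgroup N (free_group k)"
    proof (rule F.subgroupI)
      show "N \<subseteq> carrier (free_group k)" by (auto simp: N_def)
      have "\<one>\<^bsub>free_group k\<^esub> \<in> N" using agree[of "[\<one>\<^bsub>free_group k\<^esub>]"] subgroup.one_closed[OF T] by (metis list.set_intros(1))
      then show "N \<noteq> {}" by (metis empty_iff)
    next
      fix u assume "u \<in> N"
      then show "inv\<^bsub>free_group k\<^esub> u \<in> N"
        using agree[of "[u, inv\<^bsub>free_group k\<^esub> u]"] subgroup.m_inv_closed[OF T]
        by (metis list.set_intros)
    next
      fix u v assume "u \<in> N" "v \<in> N"
      then show "u \<otimes>\<^bsub>free_group k\<^esub> v \<in> N"
        using agree[of "[u, v, u \<otimes>\<^bsub>free_group k\<^esub> v]"] subgroup.m_closed[OF T]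
        by (metis list.set_intros)
    qed
  next
    fix x u assume "x \<in> carrier (free_group k)" "u \<in> N"
    then show "x \<otimes>\<^bsub>free_group k\<^esub> u \<otimes>\<^bsub>free_group k\<^esub> inv\<^bsub>free_group k\<^esub> x \<in> N"
      using agree[of "[u, x \<otimes>\<^bsub>free_group k\<^esub> u \<otimes>\<^bsub>free_group k\<^esub> inv\<^bsub>free_group k\<^esub> x]"] normal.inv_op_closed2[OF T_normal]
      by (metis list.set_intros)
  qed
  define Y where "Y = marked_iso_rel k ``
    {(free_group k Mod N, map (\<lambda>i. N #>\<^bsub>free_group k\<^esub> free_gen i) [0..<k])}"
  show thesis
  proof (rule that[OF r])
    show "Y \<in> marked_groups k"
      unfolding Y_def marked_groups_def using marked_group_quotient[OF N] by (intro quotientI) simp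
    have "trivial_word Y w = g w" if "w \<in> carrier (free_group k)" for w
      unfolding Y_def trivial_word_quotient_iff[OF N that] using that by (simp add: N_def)
    then show "\<forall>w\<in>carrier (free_group k). \<forall>\<^sub>F i in sequentially. trivial_word (X (r i)) w = trivial_word Y w"
      using g by simp
  qed
qed

section \<open>Convergence and closure in terms of short words\<close>

lemma exp_minus_nat_le:
  assumes "\<epsilon> > 0"
  obtains l :: nat where "exp (- real l) < \<epsilon>"
proof -
  obtain l :: nat where "real l > - ln \<epsilon>" using reals_Archimedean2 by blast
  then have "exp (- real l) < exp (ln \<epsilon>)" by simp
  then show thesis by (intro that) (use assms in simp)
qed

lemma BS_closure_iff:
  "X \<in> BS_closure m \<longleftrightarrow> X \<in> marked_groups 2 \<and>
     (\<forall>l. \<exists>n. admissible m n \<and> same_short_words 2 l X (BS m n))"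
proof -
  interpret M: Metric_space "marked_groups 2" "marked_dist 2" by (rule Metric_space_marked)
  have le: "same_short_words 2 l X (BS m n) \<longleftrightarrow> marked_dist 2 X (BS m n) \<le> exp (- real l)"
    if "X \<in> marked_groups 2" for l n
    by (simp add: marked_dist_le_iff that BS_in_marked_groups same_short_words_def)
  have "X \<in> BS_closure m \<longleftrightarrow> X \<in> marked_groups 2 \<and>
      (\<forall>\<epsilon>>0. \<exists>n. admissible m n \<and> marked_dist 2 X (BS m n) \<le> \<epsilon>)" (is "_ \<longleftrightarrow> _ \<and> ?E")
  proof -
    have "(\<exists>Y\<in>BS_coprime m. Y \<in> M.mcball X \<epsilon>) \<longleftrightarrow>
          (\<exists>n. admissible m n \<and> marked_dist 2 X (BS m n) \<le> \<epsilon>)" if "X \<in> marked_groups 2" for \<epsilon>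
      unfolding BS_coprime_def M.in_mcball admissible_def using BS_in_marked_groups that by blast
    then show ?thesis
      unfolding BS_closure_def marked_topology_def M.metric_closure_of_alt mem_Collect_eq
      by (intro conj_cong refl) simp
  qed
  also have "\<dots> \<longleftrightarrow> X \<in> marked_groups 2 \<and> (\<forall>l. \<exists>n. admissible m n \<and> same_short_words 2 l X (BS m n))"
    (is "_ \<longleftrightarrow> _ \<and> ?L")
  proof (rule conj_cong[OF refl])
    assume X: "X \<in> marked_groups 2"
    show "?E \<longleftrightarrow> ?L"
    proof
      assume ?E
      then show ?L unfolding le[OF X] by (meson exp_gt_zero)
    next
      assume L: ?L
      show ?E
      proof (intro allI impI)
        fix \<epsilon> :: real assume "\<epsilon> > 0"
        then obtain l :: nat where l: "exp (- real l) < \<epsilon>" by (rule exp_minus_nat_le)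
        obtain n where "admissible m n" "marked_dist 2 X (BS m n) \<le> exp (- real l)"
          using L unfolding le[OF X] by meson
        with l show "\<exists>n. admissible m n \<and> marked_dist 2 X (BS m n) \<le> \<epsilon>"
          by (meson less_imp_le order_trans)
      qed
    qed
  qed
  finally show ?thesis .
qed

lemma limitin_marked_topology:
  assumes Y: "Y \<in> marked_groups k" and X: "\<And>i. X i \<in> marked_groups k"
    and lim: "\<And>l. \<forall>\<^sub>F i in sequentially. same_short_words k l (X i) Y"
  shows "limitin (marked_topology k) X Y sequentially"
proof -
  interpret M: Metric_space "marked_groups k" "marked_dist k" by (rule Metric_space_marked)
  have "\<forall>\<^sub>F i in sequentially. X i \<in> marked_groups k \<and> marked_dist k (X i) Y < \<epsilon>" if \<epsilon>: "\<epsilon> > 0" for \<epsilon> :: real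
  proof -
    obtain l :: nat where l: "exp (- real l) < \<epsilon>" using \<epsilon> by (rule exp_minus_nat_le)
    from lim[of l] show ?thesis
    proof (rule eventually_mono)
      fix i assume "same_short_words k l (X i) Y"
      then have "marked_dist k (X i) Y \<le> exp (- real l)"
        by (simp add: marked_dist_le_iff X Y same_short_words_def)
      with l X show "X i \<in> marked_groups k \<and> marked_dist k (X i) Y < \<epsilon>" by simp
    qed
  qed
  then show ?thesis unfolding marked_topology_def M.limitin_metric using Y by blast
qed

section \<open>The m-adic integers\<close>

lemma madic_dist_le_iff:
  "\<bar>m\<bar> \<ge> 2 \<Longrightarrow> madic_dist m x y \<le> 1 / real_of_int \<bar>m\<bar> ^ h \<longleftrightarrow> m ^ h dvd x - y"
  unfolding madic_dist_def by (rule madic_abs_le_iff)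

lemma inverse_power_less:
  assumes "\<bar>m\<bar> \<ge> 2" "\<epsilon> > 0"
  obtains h where "1 / real_of_int \<bar>m\<bar> ^ h < \<epsilon>"
proof -
  have "1 / real_of_int \<bar>m\<bar> < 1" using assms(1) by simp
  from real_arch_pow_inv[OF assms(2) this] show thesis
    using that by (auto simp: power_one_over)
qed

lemma madic_Cauchy_iff:
  assumes m: "\<bar>m\<bar> \<ge> 2"
  shows "x \<in> madic_Cauchy m \<longleftrightarrow> (\<forall>h. \<exists>N. \<forall>i\<ge>N. \<forall>j\<ge>N. m ^ h dvd x i - x j)"
proof -
  interpret Metric_space UNIV "madic_dist m" by (rule Metric_space_madic) fact
  have "x \<in> madic_Cauchy m \<longleftrightarrow> (\<forall>\<epsilon>>0. \<exists>N. \<forall>i j. N \<le> i \<longrightarrow> N \<le> j \<longrightarrow> madic_dist m (x i) (x j) < \<epsilon>)"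
    by (simp add: madic_Cauchy_def MCauchy_def)
  also have "\<dots> \<longleftrightarrow> (\<forall>h. \<exists>N. \<forall>i\<ge>N. \<forall>j\<ge>N. m ^ h dvd x i - x j)"
  proof (intro iffI allI impI)
    fix h assume *: "\<forall>\<epsilon>>0. \<exists>N. \<forall>i j. N \<le> i \<longrightarrow> N \<le> j \<longrightarrow> madic_dist m (x i) (x j) < \<epsilon>"
    have "1 / real_of_int \<bar>m\<bar> ^ h > 0" using m by simp
    with * obtain N where "\<forall>i j. N \<le> i \<longrightarrow> N \<le> j \<longrightarrow> madic_dist m (x i) (x j) < 1 / real_of_int \<bar>m\<bar> ^ h"
      by blast
    then show "\<exists>N. \<forall>i\<ge>N. \<forall>j\<ge>N. m ^ h dvd x i - x j"
      unfolding madic_dist_le_iff[OF m, symmetric] by (meson less_imp_le)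
  next
    fix \<epsilon> :: real assume *: "\<forall>h. \<exists>N. \<forall>i\<ge>N. \<forall>j\<ge>N. m ^ h dvd x i - x j" and "\<epsilon> > 0"
    obtain h where "1 / real_of_int \<bar>m\<bar> ^ h < \<epsilon>" using m \<open>\<epsilon> > 0\<close> by (rule inverse_power_less)
    with * show "\<exists>N. \<forall>i j. N \<le> i \<longrightarrow> N \<le> j \<longrightarrow> madic_dist m (x i) (x j) < \<epsilon>"
      unfolding madic_dist_le_iff[OF m, symmetric] by (meson le_less_trans)
  qed
  finally show ?thesis .
qed

lemma madic_dist_tendsto_0_iff:
  assumes m: "\<bar>m\<bar> \<ge> 2"
  shows "(\<lambda>i. madic_dist m (x i) (y i)) \<longlonglongrightarrow> 0 \<longleftrightarrow> (\<forall>h. \<forall>\<^sub>F i in sequentially. m ^ h dvd x i - y i)"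
proof -
  interpret Metric_space UNIV "madic_dist m" by (rule Metric_space_madic) fact
  have "(\<lambda>i. madic_dist m (x i) (y i)) \<longlonglongrightarrow> 0 \<longleftrightarrow>
    (\<forall>\<epsilon>>0. \<forall>\<^sub>F i in sequentially. madic_dist m (x i) (y i) < \<epsilon>)"
    by (simp add: tendsto_iff dist_real_def abs_of_nonneg)
  also have "\<dots> \<longleftrightarrow> (\<forall>h. \<forall>\<^sub>F i in sequentially. m ^ h dvd x i - y i)"
  proof (intro iffI allI impI)
    fix h assume *: "\<forall>\<epsilon>>0. \<forall>\<^sub>F i in sequentially. madic_dist m (x i) (y i) < \<epsilon>"
    have "1 / real_of_int \<bar>m\<bar> ^ h > 0" using m by simp
    with * have "\<forall>\<^sub>F i in sequentially. madic_dist m (x i) (y i) < 1 / real_of_int \<bar>m\<bar> ^ h" by blast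
    then show "\<forall>\<^sub>F i in sequentially. m ^ h dvd x i - y i"
      unfolding madic_dist_le_iff[OF m, symmetric] by (rule eventually_mono) simp
  next
    fix \<epsilon> :: real assume *: "\<forall>h. \<forall>\<^sub>F i in sequentially. m ^ h dvd x i - y i" and "\<epsilon> > 0"
    obtain h where h: "1 / real_of_int \<bar>m\<bar> ^ h < \<epsilon>" using m \<open>\<epsilon> > 0\<close> by (rule inverse_power_less)
    have "\<forall>\<^sub>F i in sequentially. madic_dist m (x i) (y i) \<le> 1 / real_of_int \<bar>m\<bar> ^ h"
      unfolding madic_dist_le_iff[OF m] using * by blast
    then show "\<forall>\<^sub>F i in sequentially. madic_dist m (x i) (y i) < \<epsilon>"
      by (rule eventually_mono) (use h in simp)
  qed
  finally show ?thesis .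
qed

lemma madic_class_eq_iff:
  assumes m: "\<bar>m\<bar> \<ge> 2" and "x \<in> madic_Cauchy m" "y \<in> madic_Cauchy m"
  shows "madic_class m x = madic_class m y \<longleftrightarrow> (\<forall>h. \<forall>\<^sub>F i in sequentially. m ^ h dvd x i - y i)"
proof -
  have "madic_class m x = madic_class m y \<longleftrightarrow> (x, y) \<in> madic_rel m"
    unfolding madic_class_def by (rule eq_equiv_class_iff[OF equiv_madic_rel[OF m]]) fact+
  then show ?thesis using assms by (simp add: madic_rel_def madic_dist_tendsto_0_iff)
qed

lemma madic_Cauchy_cong:
  assumes m: "\<bar>m\<bar> \<ge> 2" and x: "x \<in> madic_Cauchy m"
    and xy: "\<And>h. \<forall>\<^sub>F i in sequentially. m ^ h dvd x i - y i"
  shows "y \<in> madic_Cauchy m" "madic_class m y = madic_class m x"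
proof -
  show y: "y \<in> madic_Cauchy m"
    unfolding madic_Cauchy_iff[OF m]
  proof
    fix h
    obtain N N' where N: "\<And>i j. i \<ge> N \<Longrightarrow> j \<ge> N \<Longrightarrow> m ^ h dvd x i - x j"
      and N': "\<And>i. i \<ge> N' \<Longrightarrow> m ^ h dvd x i - y i"
      using x xy[of h] unfolding madic_Cauchy_iff[OF m] eventually_sequentially by meson
    have "m ^ h dvd y i - y j" if "i \<ge> max N N'" "j \<ge> max N N'" for i j
    proof -
      have "m ^ h dvd (x i - x j) - (x i - y i) + (x j - y j)"
        using that by (intro dvd_add[OF dvd_diff] N N') auto
      then show ?thesis by simp
    qed
    then show "\<exists>N. \<forall>i\<ge>N. \<forall>j\<ge>N. m ^ h dvd y i - y j" by blast
  qed
  show "madic_class m y = madic_class m x"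
    using xy madic_class_eq_iff[OF m x y] by simp
qed

lemma madic_Cauchy_subseq:
  assumes m: "\<bar>m\<bar> \<ge> 2" and x: "x \<in> madic_Cauchy m" and r: "\<And>i. r i \<ge> i"
  shows "(\<lambda>i. x (r i)) \<in> madic_Cauchy m" "madic_class m (\<lambda>i. x (r i)) = madic_class m x"
proof -
  have "\<forall>\<^sub>F i in sequentially. m ^ h dvd x i - x (r i)" for h
    using x r unfolding madic_Cauchy_iff[OF m] eventually_sequentially by (meson order_trans)
  then show "(\<lambda>i. x (r i)) \<in> madic_Cauchy m" "madic_class m (\<lambda>i. x (r i)) = madic_class m x"
    using madic_Cauchy_cong[OF m x, of "\<lambda>i. x (r i)"] by blast+
qed

lemma const_madic_Cauchy: "\<bar>m\<bar> \<ge> 2 \<Longrightarrow> (\<lambda>_. n) \<in> madic_Cauchy m"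
  by (simp add: madic_Cauchy_iff)

lemma madic_int_dist_le:
  assumes m: "\<bar>m\<bar> \<ge> 2" and "x \<in> madic_Cauchy m" "y \<in> madic_Cauchy m"
    and "\<forall>\<^sub>F i in sequentially. m ^ h dvd x i - y i"
  shows "madic_int_dist m (madic_class m x) (madic_class m y) \<le> 1 / real_of_int \<bar>m\<bar> ^ h"
  by (rule tendsto_upperbound[OF madic_int_dist_class]) (use assms in \<open>simp_all add: madic_dist_le_iff[OF m] del: of_int_abs\<close>)

lemma limitin_madic_of_int:
  assumes m: "\<bar>m\<bar> \<ge> 2" and x: "x \<in> madic_Cauchy m"
  shows "limitin (madic_topology m) (\<lambda>i. madic_of_int m (x i)) (madic_class m x) sequentially"
proof -
  interpret Metric_space "carrier (madic_ring m)" "madic_int_dist m"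
    by (rule Metric_space_madic_int) fact
  have c: "madic_of_int m n \<in> carrier (madic_ring m)" for n
    unfolding madic_of_int_def by (intro madic_class_carrier const_madic_Cauchy m)
  have "\<forall>\<^sub>F i in sequentially. madic_int_dist m (madic_of_int m (x i)) (madic_class m x) < \<epsilon>"
    if "\<epsilon> > 0" for \<epsilon> :: real
  proof -
    obtain h where h: "1 / real_of_int \<bar>m\<bar> ^ h < \<epsilon>" using m \<open>\<epsilon> > 0\<close> by (rule inverse_power_less)
    obtain N where N: "\<And>i j. i \<ge> N \<Longrightarrow> j \<ge> N \<Longrightarrow> m ^ h dvd x i - x j"
      using x unfolding madic_Cauchy_iff[OF m] by meson
    have "madic_int_dist m (madic_of_int m (x i)) (madic_class m x) < \<epsilon>" if "i \<ge> N" for i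
    proof -
      have "\<forall>\<^sub>F j in sequentially. m ^ h dvd x i - x j"
        using N that unfolding eventually_sequentially by blast
      then have "madic_int_dist m (madic_of_int m (x i)) (madic_class m x) \<le> 1 / real_of_int \<bar>m\<bar> ^ h"
        unfolding madic_of_int_def by (intro madic_int_dist_le m const_madic_Cauchy x)
      with h show ?thesis by simp
    qed
    then show ?thesis unfolding eventually_sequentially by blast
  qed
  then show ?thesis
    unfolding madic_topology_def limitin_metric using c madic_class_carrier[OF x] by simp
qed

lemma madic_ring_one: "\<one>\<^bsub>madic_ring m\<^esub> = madic_class m (\<lambda>_. 1)"
  by (simp add: madic_ring_def madic_of_int_def)

text \<open>Inverses modulo \<open>m ^ i\<close> of the \<open>i\<close>-th entries form a Cauchy sequence, because inverses of congruent
  numbers are congruent; its product with \<open>x\<close> tends to \<open>1\<close>.\<close>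

lemma madic_class_Unit:
  assumes m: "\<bar>m\<bar> \<ge> 2" and x: "x \<in> madic_Cauchy m" and coprime: "\<And>i. coprime (x i) m"
  shows "madic_class m x \<in> Units (madic_ring m)"
proof -
  have "\<exists>y. m ^ i dvd x i * y - 1" for i
  proof -
    have "coprime (x i) (m ^ i)" using coprime by simp
    then obtain u v where "u * x i + v * m ^ i = 1"
      using bezout_int[of "x i" "m ^ i"] by (auto simp: coprime_iff_gcd_eq_1)
    then have "x i * u - 1 = m ^ i * (- v)" by (simp add: algebra_simps)
    then show ?thesis by (metis dvd_triv_left)
  qed
  then obtain y where y: "\<And>i. m ^ i dvd x i * y i - 1" by metis
  have y_h: "m ^ h dvd x i * y i - 1" if "h \<le> i" for h i
    using y[of i] that by (meson dvd_trans le_imp_power_dvd)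
  have yC: "y \<in> madic_Cauchy m"
    unfolding madic_Cauchy_iff[OF m]
  proof
    fix h
    obtain N where N: "\<And>i j. i \<ge> N \<Longrightarrow> j \<ge> N \<Longrightarrow> m ^ h dvd x i - x j"
      using x unfolding madic_Cauchy_iff[OF m] by meson
    have "m ^ h dvd y i - y j" if "i \<ge> max N h" "j \<ge> max N h" for i j
    proof -
      have "m ^ h dvd (x i * y i - 1) - (x j * y j - 1) - (x i - x j) * y j"
        using that by (intro dvd_diff[OF dvd_diff dvd_mult2] N y_h) auto
      then have "m ^ h dvd x i * (y i - y j)" by (simp add: algebra_simps)
      moreover have "coprime (m ^ h) (x i)" using coprime[of i] by (simp add: coprime_commute)
      ultimately show ?thesis by (simp add: coprime_dvd_mult_right_iff)
    qed
    then show "\<exists>N. \<forall>i\<ge>N. \<forall>j\<ge>N. m ^ h dvd y i - y j" by blast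
  qed
  have xyC: "(\<lambda>i. x i * y i) \<in> madic_Cauchy m"
    by (rule madic_Cauchy_op(1)[OF m madic_dist_op_le(2)[OF m] x yC])
  have "\<forall>\<^sub>F i in sequentially. m ^ h dvd x i * y i - 1" for h
    using y_h unfolding eventually_sequentially by blast
  then have "madic_class m (\<lambda>i. x i * y i) = \<one>\<^bsub>madic_ring m\<^esub>"
    unfolding madic_ring_one using madic_class_eq_iff[OF m xyC const_madic_Cauchy[OF m]] by blast
  then have "madic_class m x \<otimes>\<^bsub>madic_ring m\<^esub> madic_class m y = \<one>\<^bsub>madic_ring m\<^esub>"
    "madic_class m y \<otimes>\<^bsub>madic_ring m\<^esub> madic_class m x = \<one>\<^bsub>madic_ring m\<^esub>"
    using madic_ring_simps(2)[OF m x yC] madic_ring_simps(2)[OF m yC x] by (simp_all add: mult.commute)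
  then show ?thesis using madic_class_carrier x yC unfolding Units_def by blast
qed

text \<open>A sequence representing a unit \<open>u\<close> is eventually prime to \<open>m\<close>, since its product with a sequence
  representing the inverse is eventually \<open>1\<close> modulo \<open>m\<close>. Small entries are made large by adding
  high powers of \<open>m\<close>, which does not affect the limit.\<close>

lemma madic_Unit_admissible:
  assumes m: "\<bar>m\<bar> \<ge> 2" and u: "u \<in> Units (madic_ring m)"
  obtains n where "n \<in> madic_Cauchy m" "madic_class m n = u" "\<And>i. admissible m (n i)"
proof -
  have "u \<in> carrier (madic_ring m)"
    and "\<exists>v\<in>carrier (madic_ring m). u \<otimes>\<^bsub>madic_ring m\<^esub> v = \<one>\<^bsub>madic_ring m\<^esub>"
    using u by (auto simp: Units_def)
  then obtain x y where x: "x \<in> madic_Cauchy m" "u = madic_class m x" and y: "y \<in> madic_Cauchy m"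
    and xy: "madic_class m x \<otimes>\<^bsub>madic_ring m\<^esub> madic_class m y = \<one>\<^bsub>madic_ring m\<^esub>"
    by (metis madic_carrierE)
  have "(\<lambda>i. x i * y i) \<in> madic_Cauchy m"
    by (rule madic_Cauchy_op(1)[OF m madic_dist_op_le(2)[OF m] x(1) y])
  then have "\<forall>h. \<forall>\<^sub>F i in sequentially. m ^ h dvd x i * y i - 1"
    using xy madic_class_eq_iff[OF m _ const_madic_Cauchy[OF m]]
    by (simp add: madic_ring_simps(2)[OF m x(1) y] madic_ring_one)
  from spec[OF this, of 1] obtain N where N: "\<And>i. i \<ge> N \<Longrightarrow> m dvd x i * y i - 1"
    by (auto simp: eventually_sequentially)
  define z where "z i = x (i + N)" for i
  have z: "z \<in> madic_Cauchy m" "madic_class m z = u"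
    unfolding z_def using madic_Cauchy_subseq[OF m x(1), of "\<lambda>i. i + N"] x(2) by auto
  have z_coprime: "coprime (z i) m" for i
  proof (rule coprimeI)
    fix c assume c: "c dvd z i" "c dvd m"
    have "c dvd z i * y (i + N) - 1"
      using dvd_trans[OF c(2) N[of "i + N"]] by (simp add: z_def)
    moreover have "c dvd z i * y (i + N)" using c(1) by (rule dvd_mult2)
    ultimately have "c dvd z i * y (i + N) - (z i * y (i + N) - 1)" by (rule dvd_diff[rotated])
    then show "is_unit c" by (simp only: diff_diff_eq2 add_diff_cancel_left')
  qed
  define n where "n i = (if \<bar>z i\<bar> \<ge> 2 then z i else z i + m ^ (i + 2))" for i
  have "admissible m (n i)" for i
  proof -
    have "coprime (z i + m ^ (i + 2)) m"
    proof (rule coprimeI)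
      fix c assume "c dvd z i + m ^ (i + 2)" "c dvd m"
      then have "c dvd z i" by (simp add: dvd_add_left_iff dvd_mult2)
      then show "is_unit c" using z_coprime[of i] \<open>c dvd m\<close> coprime_common_divisor by blast
    qed
    moreover have "\<bar>z i + m ^ (i + 2)\<bar> \<ge> 2" if "\<not> \<bar>z i\<bar> \<ge> 2"
    proof -
      have "(2::int) ^ 2 \<le> 2 ^ (i + 2)" by (rule power_increasing) auto
      also have "(2::int) ^ (i + 2) \<le> \<bar>m\<bar> ^ (i + 2)" using m by (intro power_mono) auto
      also have "\<dots> = \<bar>m ^ (i + 2)\<bar>" by (simp only: power_abs)
      finally show ?thesis using that by simp
    qed
    ultimately show ?thesis using z_coprime by (simp add: admissible_def n_def)
  qed
  moreover have "\<forall>\<^sub>F i in sequentially. m ^ h dvd z i - n i" for h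
    unfolding eventually_sequentially
  proof (intro exI allI impI)
    fix i assume "h \<le> i"
    then have "m ^ h dvd m ^ (i + 2)" by (intro le_imp_power_dvd) simp
    then show "m ^ h dvd z i - n i" by (simp add: n_def)
  qed
  then have "n \<in> madic_Cauchy m" "madic_class m n = u"
    using madic_Cauchy_cong[OF m z(1)] z(2) by blast+
  ultimately show thesis by (intro that)
qed

section \<open>The extension to the closure\<close>

lemma BS_in_closure: "admissible m n \<Longrightarrow> BS m n \<in> BS_closure m"
  by (auto simp: BS_closure_iff BS_in_marked_groups same_short_words_def)

lemma eventually_same_short_words:
  assumes "\<forall>w\<in>carrier (free_group k). \<forall>\<^sub>F i in sequentially. trivial_word (X i) w = trivial_word Y w"
  shows "\<forall>\<^sub>F i in sequentially. same_short_words k l (X i) Y"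
proof -
  have "\<forall>\<^sub>F i in sequentially. \<forall>w\<in>{w \<in> carrier (free_group k). length w < l}.
          trivial_word (X i) w = trivial_word Y w"
    using assms by (intro eventually_ball_finite finite_short_words) simp
  then show ?thesis by (rule eventually_mono) (simp add: same_short_words_def)
qed

lemma same_short_words_sym: "same_short_words k l X Y \<Longrightarrow> same_short_words k l Y X"
  by (simp add: same_short_words_def)

lemma same_short_words_trans:
  "same_short_words k l X Y \<Longrightarrow> same_short_words k l Y Z \<Longrightarrow> same_short_words k l X Z"
  by (simp add: same_short_words_def)

lemma same_short_words_mono: "same_short_words k l X Y \<Longrightarrow> l' \<le> l \<Longrightarrow> same_short_words k l' X Y"
  by (simp add: same_short_words_def)

text \<open>Compactness turns convergence in \<open>\<int>\<^sub>m\<close> into a point of the closure: some subsequence of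
  \<open>BS(m, n\<^sub>i)\<close> converges to a marked group \<open>Y\<close>, and continuity forces the value at \<open>Y\<close> to be
  the limit of \<open>n\<^sub>i\<close>. The last conclusion keeps enough information about \<open>Y\<close> to
  distinguish it from a Baumslag--Solitar group.\<close>

lemma closure_point_over_madic_limit:
  assumes m: "\<bar>m\<bar> \<ge> 2" and n: "n \<in> madic_Cauchy m" "\<And>i. admissible m (n i)"
  obtains Y where "Y \<in> BS_closure m"
    "\<forall>\<Phi>. continuous_extension m \<Phi> \<longrightarrow> \<Phi> Y = madic_class m n"
    "\<forall>w\<in>carrier (free_group 2). (\<forall>i. \<not> trivial_word (BS m (n i)) w) \<longrightarrow> \<not> trivial_word Y w"
proof -
  obtain r Y where r: "strict_mono r" and Y: "Y \<in> marked_groups 2" and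
    conv: "\<forall>w\<in>carrier (free_group 2). \<forall>\<^sub>F i in sequentially. trivial_word (BS m (n (r i))) w = trivial_word Y w"
    by (rule marked_groups_convergent_subsequence[of "\<lambda>i. BS m (n i)" 2]) (rule BS_in_marked_groups)
  note short = eventually_same_short_words[OF conv]
  have Y_closure: "Y \<in> BS_closure m"
    unfolding BS_closure_iff
  proof (intro conjI allI Y)
    fix l
    obtain i where "same_short_words 2 l (BS m (n (r i))) Y"
      using short[of l] by (auto simp: eventually_sequentially)
    then show "\<exists>n. admissible m n \<and> same_short_words 2 l Y (BS m n)"
      using n(2) same_short_words_sym by blast
  qed
  have "\<Phi> Y = madic_class m n" if \<Phi>: "continuous_extension m \<Phi>" for \<Phi>
  proof -
    interpret Z: Metric_space "carrier (madic_ring m)" "madic_int_dist m"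
      by (rule Metric_space_madic_int) fact
    have "limitin (marked_topology 2) (\<lambda>i. BS m (n (r i))) Y sequentially"
      by (rule limitin_marked_topology[OF Y BS_in_marked_groups short])
    then have "limitin (subtopology (marked_topology 2) (BS_closure m)) (\<lambda>i. BS m (n (r i))) Y sequentially"
      using Y_closure n(2) by (simp add: limitin_subtopology BS_in_closure)
    then have "limitin (madic_units_topology m) (\<Phi> \<circ> (\<lambda>i. BS m (n (r i)))) (\<Phi> Y) sequentially"
      by (rule continuous_map_limit[rotated]) (use \<Phi> in \<open>simp add: continuous_extension_def\<close>)
    moreover have "\<Phi> \<circ> (\<lambda>i. BS m (n (r i))) = (\<lambda>i. madic_of_int m (n (r i)))"
      using \<Phi> n(2) by (auto simp: continuous_extension_def admissible_def)
    ultimately have "limitin (madic_topology m) (\<lambda>i. madic_of_int m (n (r i))) (\<Phi> Y) sequentially"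
      by (simp add: madic_units_topology_def limitin_subtopology)
    moreover have "limitin (madic_topology m) (\<lambda>i. madic_of_int m (n (r i))) (madic_class m n) sequentially"
      using limitin_madic_of_int[OF m, of "\<lambda>i. n (r i)"] madic_Cauchy_subseq[OF m n(1), of r]
        seq_suble[OF r] by simp
    ultimately show ?thesis
      unfolding madic_topology_def by (rule Z.limitin_metric_unique) simp
  qed
  moreover have "\<not> trivial_word Y w"
    if "w \<in> carrier (free_group 2)" "\<forall>i. \<not> trivial_word (BS m (n i)) w" for w
    using conv that by (auto simp: eventually_sequentially)
  ultimately show thesis using Y_closure by (intro that) blast+
qed

lemma topspace_BS_closure: "topspace (subtopology (marked_topology 2) (BS_closure m)) = BS_closure m"
  by (simp add: BS_closure_def closure_of_subset_topspace inf_absorb2)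

text \<open>Approximate \<open>X\<close> in the closure by groups \<open>BS(m, n\<^sub>l)\<close> with the same trivial words of length less
  than \<open>l\<close>. As short words determine \<open>n\<close> modulo powers of \<open>m\<close>, the sequence \<open>n\<^sub>l\<close> is Cauchy, its
  limit depends continuously on \<open>X\<close>, and all its entries are prime to \<open>m\<close>.\<close>

lemma continuous_extension_exists:
  assumes m: "\<bar>m\<bar> \<ge> 2"
  shows "\<exists>\<Phi>. continuous_extension m \<Phi>"
proof -
  interpret G: Metric_space "marked_groups 2" "marked_dist 2" by (rule Metric_space_marked)
  interpret Z: Metric_space "carrier (madic_ring m)" "madic_int_dist m"
    by (rule Metric_space_madic_int) fact
  define pick where "pick X l = (SOME n. admissible m n \<and> same_short_words 2 l X (BS m n))" for X l
  define \<Phi> where "\<Phi> X = madic_class m (pick X)" for X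
  have pick: "admissible m (pick X l)" "same_short_words 2 l X (BS m (pick X l))"
    if "X \<in> BS_closure m" for X l
    using someI_ex[of "\<lambda>n. admissible m n \<and> same_short_words 2 l X (BS m n)"] that
    unfolding pick_def BS_closure_iff by blast+
  have near: "\<exists>L. \<forall>X\<in>BS_closure m. \<forall>Y\<in>BS_closure m. same_short_words 2 L X Y \<longrightarrow>
      (\<forall>i\<ge>L. \<forall>j\<ge>L. m ^ h dvd pick X i - pick Y j)" for h
  proof -
    obtain L where L: "\<And>n n'. admissible m n \<Longrightarrow> admissible m n' \<Longrightarrow>
        same_short_words 2 L (BS m n) (BS m n') \<Longrightarrow> m ^ h dvd n - n'"
      using m short_words_determine_congruence by blast
    have "m ^ h dvd pick X i - pick Y j"
      if "X \<in> BS_closure m" "Y \<in> BS_closure m" "same_short_words 2 L X Y" "i \<ge> L" "j \<ge> L" for X Y i j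
    proof (rule L)
      show "same_short_words 2 L (BS m (pick X i)) (BS m (pick Y j))"
        using that pick(2) by (meson same_short_words_mono same_short_words_sym same_short_words_trans)
    qed (use that pick in auto)
    then show ?thesis by blast
  qed
  have Cauchy: "pick X \<in> madic_Cauchy m" if "X \<in> BS_closure m" for X
    unfolding madic_Cauchy_iff[OF m] using near that by (metis same_short_words_def)
  have \<Phi>_BS: "\<Phi> (BS m n) = madic_of_int m n" if n: "admissible m n" for n
  proof -
    have "\<forall>\<^sub>F i in sequentially. m ^ h dvd pick (BS m n) i - n" for h
    proof -
      obtain L where L: "\<And>n n'. admissible m n \<Longrightarrow> admissible m n' \<Longrightarrow>
          same_short_words 2 L (BS m n) (BS m n') \<Longrightarrow> m ^ h dvd n - n'"
        using m short_words_determine_congruence by blast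
      have "m ^ h dvd pick (BS m n) i - n" if "i \<ge> L" for i
        by (rule L[OF pick(1) n same_short_words_sym[OF same_short_words_mono[OF pick(2) that]]])
           (intro BS_in_closure n)+
      then show ?thesis unfolding eventually_sequentially by blast
    qed
    then show ?thesis
      unfolding \<Phi>_def madic_of_int_def
      using madic_class_eq_iff[OF m Cauchy[OF BS_in_closure[OF n]] const_madic_Cauchy[OF m]] by blast
  qed
  have unit: "\<Phi> X \<in> Units (madic_ring m)" if "X \<in> BS_closure m" for X
    unfolding \<Phi>_def using pick(1)[OF that] by (intro madic_class_Unit m Cauchy that) (simp add: admissible_def)
  have carrier: "\<Phi> X \<in> carrier (madic_ring m)" if "X \<in> BS_closure m" for X
    unfolding \<Phi>_def by (intro madic_class_carrier Cauchy that)
  have "continuous_map (subtopology (marked_topology 2) (BS_closure m)) (madic_topology m) \<Phi>"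
    unfolding madic_topology_def Z.continuous_map_to_metric topspace_BS_closure
  proof (intro ballI allI impI)
    fix X and \<epsilon> :: real assume X: "X \<in> BS_closure m" and "\<epsilon> > 0"
    obtain h where h: "1 / real_of_int \<bar>m\<bar> ^ h < \<epsilon>" using m \<open>\<epsilon> > 0\<close> by (rule inverse_power_less)
    obtain L where L: "\<And>Y. Y \<in> BS_closure m \<Longrightarrow> same_short_words 2 L X Y \<Longrightarrow>
        \<forall>i\<ge>L. \<forall>j\<ge>L. m ^ h dvd pick X i - pick Y j"
      using near[of h] X by blast
    define U where "U = BS_closure m \<inter> G.mball X (exp (- real L))"
    have marked: "Y \<in> marked_groups 2" if "Y \<in> BS_closure m" for Y
      using that by (simp add: BS_closure_iff)
    have "openin (subtopology (marked_topology 2) (BS_closure m)) U"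
      unfolding U_def marked_topology_def by (intro openin_subtopology_Int2 G.openin_mball)
    moreover have "X \<in> U" using X marked by (simp add: U_def)
    moreover have "\<Phi> Y \<in> Z.mball (\<Phi> X) \<epsilon>" if "Y \<in> U" for Y
    proof -
      have Y: "Y \<in> BS_closure m" and "marked_dist 2 X Y \<le> exp (- real L)"
        using that by (auto simp: U_def)
      then have "same_short_words 2 L X Y"
        using marked_dist_le_iff[OF marked[OF X] marked[OF Y]] by (simp add: same_short_words_def)
      then have "\<forall>\<^sub>F i in sequentially. m ^ h dvd pick X i - pick Y i"
        using L[OF Y] unfolding eventually_sequentially by blast
      then have "madic_int_dist m (\<Phi> X) (\<Phi> Y) \<le> 1 / real_of_int \<bar>m\<bar> ^ h"
        unfolding \<Phi>_def by (intro madic_int_dist_le m Cauchy X Y)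
      then show ?thesis using h carrier X Y by simp
    qed
    ultimately show "\<exists>U. openin (subtopology (marked_topology 2) (BS_closure m)) U \<and>
        X \<in> U \<and> (\<forall>Y\<in>U. \<Phi> Y \<in> Z.mball (\<Phi> X) \<epsilon>)"
      by blast
  qed
  then have "continuous_map (subtopology (marked_topology 2) (BS_closure m)) (madic_units_topology m) \<Phi>"
    unfolding madic_units_topology_def continuous_map_in_subtopology topspace_BS_closure
    using unit by blast
  then show ?thesis unfolding continuous_extension_def using \<Phi>_BS by (auto simp: admissible_def)
qed

lemma continuous_extension_image:
  assumes m: "\<bar>m\<bar> \<ge> 2" and \<Phi>: "continuous_extension m \<Phi>"
  shows "\<Phi> ` BS_closure m = Units (madic_ring m)"
proof
  have "\<Phi> ` topspace (subtopology (marked_topology 2) (BS_closure m)) \<subseteq> topspace (madic_units_topology m)"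
    using \<Phi> continuous_map_image_subset_topspace unfolding continuous_extension_def by blast
  then show "\<Phi> ` BS_closure m \<subseteq> Units (madic_ring m)"
    unfolding topspace_BS_closure madic_units_topology_def by auto
  show "Units (madic_ring m) \<subseteq> \<Phi> ` BS_closure m"
  proof
    fix u assume "u \<in> Units (madic_ring m)"
    with m obtain n where n: "n \<in> madic_Cauchy m" "madic_class m n = u" "\<And>i. admissible m (n i)"
      using madic_Unit_admissible by blast
    obtain Y where "Y \<in> BS_closure m" "\<forall>\<Phi>. continuous_extension m \<Phi> \<longrightarrow> \<Phi> Y = madic_class m n"
      using closure_point_over_madic_limit[OF m n(1,3)] by metis
    then show "u \<in> \<Phi> ` BS_closure m" using \<Phi> n(2) by blast
  qed
qed

text \<open>Take \<open>n\<^sub>0 = \<bar>m\<bar> + 1\<close>. The integers \<open>n\<^sub>i = n\<^sub>0 + \<bar>m\<bar> ^ (i + 1)\<close> converge to \<open>n\<^sub>0\<close>, but a limit point of the groups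
  \<open>BS(m, n\<^sub>i)\<close> cannot be \<open>BS(m, n\<^sub>0)\<close>, as the relator of the latter is trivial in none of them.\<close>

lemma continuous_extension_not_inj:
  assumes m: "\<bar>m\<bar> \<ge> 2" and \<Phi>: "continuous_extension m \<Phi>"
  shows "\<not> inj_on \<Phi> (BS_closure m)"
proof
  assume inj: "inj_on \<Phi> (BS_closure m)"
  define n0 where "n0 = \<bar>m\<bar> + 1"
  define n where "n i = n0 + \<bar>m\<bar> ^ (i + 1)" for i :: nat
  have "coprime (1 + \<bar>m\<bar> * k) m" for k
  proof (rule coprimeI)
    fix c assume c: "c dvd 1 + \<bar>m\<bar> * k" "c dvd m"
    then have "c dvd \<bar>m\<bar> * k" by simp
    with c(1) show "is_unit c" using dvd_add_left_iff by blast
  qed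
  from this[of 1] this[of "1 + \<bar>m\<bar> ^ i" for i] have coprime: "coprime n0 m" "coprime (n i) m" for i
    by (simp_all add: n0_def n_def algebra_simps)
  have big: "2 \<le> n0" "n0 < n i" for i using m by (simp_all add: n0_def n_def)
  have adm0: "admissible m n0" using coprime(1) big(1) by (simp add: admissible_def)
  have adm: "admissible m (n i)" for i
    using coprime(2)[of i] big(1) big(2)[of i] by (simp add: admissible_def)
  have "\<forall>\<^sub>F i in sequentially. m ^ h dvd n0 - n i" for h
    unfolding eventually_sequentially
  proof (intro exI allI impI)
    fix i assume "h \<le> i"
    then have "m ^ h dvd m ^ (i + 1)" by (intro le_imp_power_dvd) simp
    then show "m ^ h dvd n0 - n i" by (simp add: n_def flip: power_abs power_Suc)
  qed
  then have n: "n \<in> madic_Cauchy m" "madic_class m n = madic_of_int m n0"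
    unfolding madic_of_int_def using madic_Cauchy_cong[OF m const_madic_Cauchy[OF m, of n0], of n] by blast+
  obtain Y where Y: "Y \<in> BS_closure m"
    "\<forall>\<Phi>. continuous_extension m \<Phi> \<longrightarrow> \<Phi> Y = madic_class m n"
    "\<forall>w\<in>carrier (free_group 2). (\<forall>i. \<not> trivial_word (BS m (n i)) w) \<longrightarrow> \<not> trivial_word Y w"
    using closure_point_over_madic_limit[OF m n(1) adm] by metis
  have "\<Phi> Y = \<Phi> (BS m n0)" using Y(2) \<Phi> n(2) adm0 by (simp add: continuous_extension_def admissible_def)
  then have "Y = BS m n0" by (rule inj_onD[OF inj _ Y(1) BS_in_closure[OF adm0]])
  moreover have nz: "m \<noteq> 0" "n i \<noteq> 0" "n0 \<noteq> 0" "n0 \<noteq> n i" for i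
    using m big(1) big(2)[of i] by auto
  then have "\<not> trivial_word Y (BS_relator m n0)"
    using Y(3) BS_relator_in_free_group trivial_BS_relator_iff by blast
  moreover have "trivial_word (BS m n0) (BS_relator m n0)"
    using trivial_BS_relator_iff nz by blast
  ultimately show False by blast
qed

theorem theorem4:
  fixes m :: int
  assumes "\<bar>m\<bar> \<ge> 2"
  shows "(\<exists>\<Phi>. continuous_extension m \<Phi>) \<and>
         (\<forall>\<Phi>. continuous_extension m \<Phi> \<longrightarrow>
            \<Phi> ` BS_closure m = Units (madic_ring m) \<and> \<not> inj_on \<Phi> (BS_closure m))"
  using continuous_extension_exists[OF assms] continuous_extension_image[OF assms]
    continuous_extension_not_inj[OF assms] by blast

end
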